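(* Let $a,b,a',b'>0$ with $\frac{ab'}{a'b}>1$. There is only one function $\varphi:[0,b]\to[0,b']$ with $\varphi(0)=0$, $\varphi(b)=b'$ and $\dot\varphi\ge\frac{a'}{a}$ such that $f_\varphi$ can be lifted into a quasiconformal map $\widetilde f:C_{a,b}\to C_{a',b'}$. That function is defined by $$\varphi(x)=\frac{b'x}{\left(1-\frac{ab'}{a'b}\right)x+\frac{ab'}{a'}},$$ and the lifts are the rotations around the vertical axis of the map $\widetilde f_0:C_{a,b}\to C_{a',b'}$, $$\widetilde f_0(z,t)=\left(\frac{\sqrt{b'}\,z\,e^{\frac{i}{2b}\left(1-\frac{a'b}{ab'}\right)t}}{\sqrt{\left(1-\frac{ab'}{a'b}\right)|z|^2+\frac{ab'}{a'}}},\ \frac{a'}{a}t\right).$$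
   Context: The Heisenberg group $\mathbf{H}$ is $\mathbb{C}\times\mathbb{R}$ with law $(z,t)\ast(z',t')=(z+z',t+t'+2\Im(z\overline{z'}))$, norm $\|(z,t)\|=(|z|^4+t^2)^{1/4}$ and distance $d(p,q)=\|p^{-1}\ast q\|$. Set $Z=\partial_z+i\overline z\,\partial_t$, $\overline Z=\partial_{\overline z}-iz\,\partial_t$ and $\omega=dt-i\overline z\,dz+iz\,d\overline z$. A homeomorphism $f$ between domains of $\mathbf{H}$ is quasiconformal if $H(p,f)=\limsup_{r\to0}\frac{\max_{d(p,q)=r}d(f(p),f(q))}{\min_{d(p,q)=r}d(f(p),f(q))}$ is uniformly bounded. Standing assumption: all quasiconformal maps (in $\mathbf{H}$ and in $\mathbb{C}$) are $C^2$ and orientation preserving. Such a map $f=(f_1,f_2)$ of $\mathbf{H}$ is contact ($f^\ast\omega=\lambda\omega$ with $\lambda$ a nowhere vanishing real function), and orientation preserving means that $\overline Zf_1=\mu Zf_1$ and $\overline Z(f_2+i|f_1|^2)=\mu Z(f_2+i|f_1|^2)$ for some $\mu\in L^\infty$ with $\|\mu\|_{L^\infty}<1$. For $r,R>0$: $C_{r,R}=\{(z,t)\in\mathbf{H}\mid0<t<r,\ |z|<\sqrt R\}$ and $R_{r,R}=\{w\in\mathbb{H}\mid0<\Re(w)<r,\ 0<\Im(w)<R\}$, where $\mathbb{H}$ is the upper half-plane. $\Pi(z,t)=t+i|z|^2$, so $\Pi(C_{r,R}\setminus\{z=0\})=R_{r,R}$. For $\varphi$ as in the claim, $f_\varphi:R_{a,b}\to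 R_{a',b'}$ is $f_\varphi(x+iy)=\frac{a'}{a}x+i\varphi(y)$. A lift of $f_\varphi$ is a quasiconformal map $\widetilde f:C_{a,b}\to C_{a',b'}$ with $\Pi\circ\widetilde f=f_\varphi\circ\Pi$. The rotations of $\widetilde f_0=(f_1,f_2)$ around the vertical axis are the maps $\widetilde f_\alpha=(e^{i\alpha}f_1,f_2)$, $\alpha\in\mathbb{R}$. A dot denotes the derivative of $\varphi$. *)

theory Defs
  imports "HOL-Analysis.Analysis" "HOL-Probability.Essential_Supremum"
begin

type_synonym heis = "complex \<times> real"

definition heis_mult :: "heis \<Rightarrow> heis \<Rightarrow> heis" where
  "heis_mult p q =
     (fst p + fst q, snd p + snd q + 2 * Im (fst p * cnj (fst q)))"

text \<open>The neutral element is \<open>(0, 0)\<close>; since \<open>Im (z * cnj z) = 0\<close>, the inverse of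
  \<open>(z, t)\<close> is \<open>(- z, - t)\<close>.\<close>

definition heis_inv :: "heis \<Rightarrow> heis" where
  "heis_inv p = (- fst p, - snd p)"

definition heis_norm :: "heis \<Rightarrow> real" where
  "heis_norm p = root 4 (cmod (fst p) ^ 4 + (snd p)\<^sup>2)"

text \<open>Not to be confused with \<^const>\<open>dist\<close>, the product metric on \<^typ>\<open>complex \<times> real\<close>.
  Both induce the same topology, so topological notions below are those of the library.\<close>

definition heis_dist :: "heis \<Rightarrow> heis \<Rightarrow> real" where
  "heis_dist p q = heis_norm (heis_mult (heis_inv p) q)"

text \<open>The fields \<open>Z = \<partial>/\<partial>z + i cnj z \<partial>/\<partial>t\<close> and \<open>Zbar = \<partial>/\<partial>(cnj z) - i z \<partial>/\<partial>t\<close>, with the Wirtinger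
  derivatives \<open>\<partial>/\<partial>z = (\<partial>/\<partial>x - i \<partial>/\<partial>y) / 2\<close> and \<open>\<partial>/\<partial>(cnj z) = (\<partial>/\<partial>x + i \<partial>/\<partial>y) / 2\<close>.\<close>

definition heis_Z :: "(heis \<Rightarrow> complex) \<Rightarrow> heis \<Rightarrow> complex" where
  "heis_Z g p = (let D = frechet_derivative g (at p) in
     (D (1, 0) - \<i> * D (\<i>, 0)) / 2 + \<i> * cnj (fst p) * D (0, 1))"

definition heis_Zbar :: "(heis \<Rightarrow> complex) \<Rightarrow> heis \<Rightarrow> complex" where
  "heis_Zbar g p = (let D = frechet_derivative g (at p) in
     (D (1, 0) + \<i> * D (\<i>, 0)) / 2 - \<i> * fst p * D (0, 1))"

text \<open>\<open>heis_form p v\<close> is the value of \<open>\<omega> = dt - i cnj z dz + i z d(cnj z)\<close> at the point \<open>p\<close>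
  on the tangent vector \<open>v\<close>.\<close>

definition heis_form :: "heis \<Rightarrow> heis \<Rightarrow> complex" where
  "heis_form p v =
     of_real (snd v) - \<i> * cnj (fst p) * fst v + \<i> * fst p * cnj (fst v)"

definition contact_on :: "heis set \<Rightarrow> (heis \<Rightarrow> heis) \<Rightarrow> bool" where
  "contact_on U f \<longleftrightarrow> (\<exists>lam :: heis \<Rightarrow> real. \<forall>p\<in>U. lam p \<noteq> 0 \<and>
     (\<forall>v. heis_form (f p) (frechet_derivative f (at p) v)
          = of_real (lam p) * heis_form p v))"

definition C2_on :: "'a::real_normed_vector set \<Rightarrow> ('a \<Rightarrow> 'b::real_normed_vector) \<Rightarrow> bool" where
  "C2_on U f \<longleftrightarrow> (\<exists>(f' :: 'a \<Rightarrow> 'a \<Rightarrow>\<^sub>L 'b) (f'' :: 'a \<Rightarrow> 'a \<Rightarrow>\<^sub>L ('a \<Rightarrow>\<^sub>L 'b)).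
     (\<forall>x\<in>U. (f has_derivative blinfun_apply (f' x)) (at x)) \<and>
     (\<forall>x\<in>U. (f' has_derivative blinfun_apply (f'' x)) (at x)) \<and>
     continuous_on U f'')"

definition orientation_preserving_on :: "heis set \<Rightarrow> (heis \<Rightarrow> heis) \<Rightarrow> bool" where
  "orientation_preserving_on U f \<longleftrightarrow>
     (let f1 = (\<lambda>p. fst (f p));
          h = (\<lambda>p. of_real (snd (f p)) + \<i> * of_real ((cmod (fst (f p)))\<^sup>2))
      in \<exists>\<mu> :: heis \<Rightarrow> complex.
           \<mu> \<in> borel_measurable (lebesgue_on U) \<and>
           esssup (lebesgue_on U) (\<lambda>p. ereal (cmod (\<mu> p))) < 1 \<and>
           (AE p in lebesgue_on U. heis_Zbar f1 p = \<mu> p * heis_Z f1 p \<and>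
                                   heis_Zbar h p = \<mu> p * heis_Z h p))"

text \<open>For \<open>p\<close> in an open set \<open>U\<close> and small \<open>r\<close> the sphere of radius \<open>r\<close> around \<open>p\<close> is a
  compact subset of \<open>U\<close>, so for continuous \<open>f\<close> the supremum and the infimum are attained,
  i.e. they are a maximum and a minimum.\<close>

definition distortion :: "heis set \<Rightarrow> (heis \<Rightarrow> heis) \<Rightarrow> heis \<Rightarrow> ereal" where
  "distortion U f p = Limsup (at_right 0) (\<lambda>r.
     (SUP q\<in>{q\<in>U. heis_dist p q = r}. ereal (heis_dist (f p) (f q))) /
     (INF q\<in>{q\<in>U. heis_dist p q = r}. ereal (heis_dist (f p) (f q))))"

definition heis_domain :: "heis set \<Rightarrow> bool" where
  "heis_domain U \<longleftrightarrow> open U \<and> connected U \<and> U \<noteq> {}"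

text \<open>Quasiconformal maps of \<open>U\<close> onto \<open>V\<close> under the standing convention that they are of class
  \<open>C\<^sup>2\<close> and orientation preserving contact maps. The Beltrami equations alone already give
  \<open>f\<^sup>* \<omega> = \<lambda> \<omega>\<close> with real \<open>\<lambda>\<close>, so \<^const>\<open>contact_on\<close> only adds that \<open>\<lambda>\<close> has no zero.\<close>

definition heis_quasiconformal :: "heis set \<Rightarrow> heis set \<Rightarrow> (heis \<Rightarrow> heis) \<Rightarrow> bool" where
  "heis_quasiconformal U V f \<longleftrightarrow>
     heis_domain U \<and> heis_domain V \<and>
     (\<exists>g. homeomorphism U V f g) \<and>
     (\<exists>K :: real. \<forall>p\<in>U. distortion U f p \<le> ereal K) \<and>
     C2_on U f \<and> contact_on U f \<and> orientation_preserving_on U f"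

definition cyl :: "real \<Rightarrow> real \<Rightarrow> heis set" where
  "cyl r R = {(z, t). 0 < t \<and> t < r \<and> cmod z < sqrt R}"

definition rect :: "real \<Rightarrow> real \<Rightarrow> complex set" where
  "rect r R = {w. 0 < Re w \<and> Re w < r \<and> 0 < Im w \<and> Im w < R}"

definition heis_proj :: "heis \<Rightarrow> complex" where
  "heis_proj p = of_real (snd p) + \<i> * of_real ((cmod (fst p))\<^sup>2)"

definition f_phi :: "real \<Rightarrow> real \<Rightarrow> (real \<Rightarrow> real) \<Rightarrow> complex \<Rightarrow> complex" where
  "f_phi a a' \<phi> w = Complex (a' / a * Re w) (\<phi> (Im w))"

text \<open>The derivative is one-sided at \<open>0\<close> and \<open>b\<close>. Only the values of \<open>\<phi>\<close> on \<open>[0, b]\<close> matter.\<close>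

definition admissible ::
    "real \<Rightarrow> real \<Rightarrow> real \<Rightarrow> real \<Rightarrow> (real \<Rightarrow> real) \<Rightarrow> bool" where
  "admissible a b a' b' \<phi> \<longleftrightarrow>
     \<phi> \<in> {0..b} \<rightarrow> {0..b'} \<and> \<phi> 0 = 0 \<and> \<phi> b = b' \<and>
     (\<forall>x\<in>{0..b}. \<exists>D. (\<phi> has_real_derivative D) (at x within {0..b}) \<and> D \<ge> a' / a)"

text \<open>The map \<open>f_phi a a' \<phi>\<close> lives on \<open>rect a b\<close>, the image of the points of \<open>cyl a b\<close> off the
  axis \<open>z = 0\<close>, so this is where the two compositions are compared.\<close>

definition is_lift ::
    "real \<Rightarrow> real \<Rightarrow> real \<Rightarrow> real \<Rightarrow> (real \<Rightarrow> real) \<Rightarrow> (heis \<Rightarrow> heis) \<Rightarrow> bool" where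
  "is_lift a b a' b' \<phi> f \<longleftrightarrow>
     heis_quasiconformal (cyl a b) (cyl a' b') f \<and>
     (\<forall>p\<in>cyl a b. heis_proj p \<in> rect a b \<longrightarrow> heis_proj (f p) = f_phi a a' \<phi> (heis_proj p))"

definition heis_rot :: "real \<Rightarrow> heis \<Rightarrow> heis" where
  "heis_rot \<alpha> p = (exp (\<i> * of_real \<alpha>) * fst p, snd p)"

definition phi0 :: "real \<Rightarrow> real \<Rightarrow> real \<Rightarrow> real \<Rightarrow> real \<Rightarrow> real" where
  "phi0 a b a' b' x =
     b' * x / ((1 - a * b' / (a' * b)) * x + a * b' / a')"

definition lift0 :: "real \<Rightarrow> real \<Rightarrow> real \<Rightarrow> real \<Rightarrow> heis \<Rightarrow> heis" where
  "lift0 a b a' b' = (\<lambda>(z, t).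
     (of_real (sqrt b') * z *
        exp (\<i> / of_real (2 * b) * of_real (1 - a' * b / (a * b')) * of_real t) /
        of_real (sqrt ((1 - a * b' / (a' * b)) * (cmod z)\<^sup>2 + a * b' / a')),
      a' / a * t))"

end

theory Submission
  imports Defs "HOL-Probability.Characteristic_Functions"
begin

text \<open>
  Put \<open>k = a' / a\<close> and \<open>x = \<bar>z\<bar>\<^sup>2\<close>. Off the axis a lift has the form \<open>(sqrt (\<phi> x) * exp (i \<psi>), k t)\<close>, and the
  contact condition reads \<open>k dt + 2 \<phi> d\<psi> = \<lambda> (dt + 2 x d\<theta>)\<close> with \<open>\<theta> = arg z\<close>. There is no \<open>dx\<close> term, so \<open>\<psi>\<close>
  depends on \<open>\<theta>\<close> and \<open>t\<close> only; with \<open>A = \<partial>\<psi>/\<partial>\<theta>\<close> and \<open>B = \<partial>\<psi>/\<partial>t\<close>, eliminating \<open>\<lambda>\<close> gives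
  \<open>\<phi> x * A = x * (k + 2 * \<phi> x * B)\<close>. Comparing two values of \<open>x\<close> shows that \<open>A\<close> and \<open>B\<close> are constants, and
  \<open>\<phi> x = k x / (A - 2 B x)\<close>. Single-valuedness makes \<open>A\<close> an integer, \<open>\<phi> 0 = 0\<close> and \<open>\<phi>' \<ge> k\<close> force \<open>A = 1\<close>,
  and \<open>\<phi> b = b'\<close> determines \<open>B\<close>.

  Conversely, the maps \<open>(z, t) \<mapsto> (sqrt (k / (1 - 2 B x)) * z * exp (i (\<alpha> + B t)), k t)\<close> are contact maps with
  factor \<open>k / (1 - 2 B x)\<close>, and their inverses are of the same kind. So a local Lipschitz bound for this
  family is also a bound from below for each of its members, and hence bounds the distortion.
\<close>

section \<open>Calculus of twice continuously differentiable maps\<close>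

definition C1_on :: "'a::real_normed_vector set \<Rightarrow> ('a \<Rightarrow> 'b::real_normed_vector) \<Rightarrow> bool" where
  "C1_on U f \<longleftrightarrow> (\<exists>f' :: 'a \<Rightarrow> 'a \<Rightarrow>\<^sub>L 'b.
     (\<forall>x\<in>U. (f has_derivative blinfun_apply (f' x)) (at x)) \<and> continuous_on U f')"

text \<open>This splits off one derivative: each closure rule for \<open>C2_on\<close> below follows
  from the formula for the first derivative and the closure rules for \<open>C1_on\<close> applied
  to that formula.\<close>

lemma C2_on_iff_C1_on:
  "C2_on U f \<longleftrightarrow> (\<exists>f'. (\<forall>x\<in>U. (f has_derivative blinfun_apply (f' x)) (at x)) \<and> C1_on U f')"
  unfolding C2_on_def C1_on_def by simp

lemma C1_on_imp_continuous_on: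
  assumes "C1_on U f"
  shows "continuous_on U f"
proof -
  obtain f' where f': "\<forall>x\<in>U. (f has_derivative blinfun_apply (f' x)) (at x)"
    using assms unfolding C1_on_def by blast
  show ?thesis
    by (intro continuous_at_imp_continuous_on ballI has_derivative_continuous[OF bspec[OF f']])
qed

lemma C2_on_imp_C1_on:
  assumes "C2_on U f"
  shows "C1_on U f"
proof -
  obtain f' where f': "\<forall>x\<in>U. (f has_derivative blinfun_apply (f' x)) (at x)" "C1_on U f'"
    using assms unfolding C2_on_iff_C1_on by blast
  have "continuous_on U f'"
    by (rule C1_on_imp_continuous_on[OF f'(2)])
  with f'(1) show ?thesis
    unfolding C1_on_def by blast
qed

lemma C1_on_const: "C1_on U (\<lambda>x. c)"
  unfolding C1_on_def by (intro exI[of _ "\<lambda>x. 0"]) (auto simp: zero_blinfun.rep_eq)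

lemma C1_on_bounded_linear:
  assumes "bounded_linear l"
  shows "C1_on U l"
  unfolding C1_on_def
  by (intro exI[of _ "\<lambda>x. Blinfun l"])
    (auto simp: bounded_linear_Blinfun_apply[OF assms] bounded_linear_imp_has_derivative[OF assms])

lemma C1_on_add:
  assumes "C1_on U f" "C1_on U g"
  shows "C1_on U (\<lambda>x. f x + g x)"
proof -
  obtain f' where f': "\<forall>x\<in>U. (f has_derivative blinfun_apply (f' x)) (at x)" "continuous_on U f'"
    using assms(1) unfolding C1_on_def by blast
  obtain g' where g': "\<forall>x\<in>U. (g has_derivative blinfun_apply (g' x)) (at x)" "continuous_on U g'"
    using assms(2) unfolding C1_on_def by blast
  show ?thesis
    unfolding C1_on_def
  proof (intro exI conjI ballI)
    show "continuous_on U (\<lambda>x. f' x + g' x)"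
      using f' g' by (intro continuous_intros)
    show "((\<lambda>x. f x + g x) has_derivative blinfun_apply (f' x + g' x)) (at x)" if "x \<in> U" for x
      using has_derivative_add[OF bspec[OF f'(1) that] bspec[OF g'(1) that]] by (simp add: plus_blinfun.rep_eq)
  qed
qed

context bounded_bilinear
begin

text \<open>The product rule is written with \<open>prod_left\<close> and \<open>prod_right\<close>,
  which are bounded linear in the factor they freeze. So the derivative is again a sum of bounded
  bilinear expressions in \<open>f\<close>, \<open>g\<close>, \<open>f'\<close>, \<open>g'\<close>,
  and its regularity follows from that of these maps.\<close>

lemma has_derivative_blinfun:
  assumes "(f has_derivative blinfun_apply f') (at x)" "(g has_derivative blinfun_apply g') (at x)"
  shows "((\<lambda>x. prod (f x) (g x)) has_derivative
    blinfun_apply ((prod_right (f x) o\<^sub>L g') + (prod_left (g x) o\<^sub>L f'))) (at x)"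
  by (rule has_derivative_eq_rhs[OF FDERIV[OF assms]]) (auto simp: plus_blinfun.rep_eq)

lemma C1_on:
  assumes "C1_on U f" "C1_on U g"
  shows "C1_on U (\<lambda>x. prod (f x) (g x))"
proof -
  obtain f' where f': "\<forall>x\<in>U. (f has_derivative blinfun_apply (f' x)) (at x)" "continuous_on U f'"
    using assms(1) unfolding C1_on_def by blast
  obtain g' where g': "\<forall>x\<in>U. (g has_derivative blinfun_apply (g' x)) (at x)" "continuous_on U g'"
    using assms(2) unfolding C1_on_def by blast
  show ?thesis
    unfolding C1_on_def
  proof (intro exI conjI ballI)
    show "continuous_on U (\<lambda>x. (prod_right (f x) o\<^sub>L g' x) + (prod_left (g x) o\<^sub>L f' x))"
      using f' g' assms[THEN C1_on_imp_continuous_on]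
      by (intro continuous_intros bounded_linear.continuous_on[OF bounded_linear_prod_right]
          bounded_linear.continuous_on[OF bounded_linear_prod_left]
          bounded_bilinear.continuous_on[OF bounded_bilinear_blinfun_compose])
    show "((\<lambda>x. prod (f x) (g x)) has_derivative blinfun_apply
        ((prod_right (f x) o\<^sub>L g' x) + (prod_left (g x) o\<^sub>L f' x))) (at x)" if "x \<in> U" for x
      by (rule has_derivative_blinfun[OF bspec[OF f'(1) that] bspec[OF g'(1) that]])
  qed
qed

end

lemma C1_on_compose:
  assumes "C1_on V g" "C1_on U f" "f ` U \<subseteq> V"
  shows "C1_on U (\<lambda>x. g (f x))"
proof -
  obtain f' where f': "\<forall>x\<in>U. (f has_derivative blinfun_apply (f' x)) (at x)" "continuous_on U f'"
    using assms(2) unfolding C1_on_def by blast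
  obtain g' where g': "\<forall>x\<in>V. (g has_derivative blinfun_apply (g' x)) (at x)" "continuous_on V g'"
    using assms(1) unfolding C1_on_def by blast
  have "continuous_on U (\<lambda>x. g' (f x))"
    using continuous_on_compose2[OF g'(2) C1_on_imp_continuous_on[OF assms(2)] assms(3)] .
  then have "continuous_on U (\<lambda>x. g' (f x) o\<^sub>L f' x)"
    using f'(2) by (intro bounded_bilinear.continuous_on[OF bounded_bilinear_blinfun_compose])
  moreover have "((\<lambda>x. g (f x)) has_derivative blinfun_apply (g' (f x) o\<^sub>L f' x)) (at x)" if "x \<in> U" for x
  proof -
    have "f x \<in> V"
      using that assms(3) by blast
    then show ?thesis
      using has_derivative_compose[OF bspec[OF f'(1) that] bspec[OF g'(1)]] by (simp add: blinfun_compose.rep_eq o_def)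
  qed
  ultimately show ?thesis
    unfolding C1_on_def by (intro exI[of _ "\<lambda>x. g' (f x) o\<^sub>L f' x"]) simp
qed

lemma C2_on_const: "C2_on U (\<lambda>x. c)"
  unfolding C2_on_iff_C1_on
  by (intro exI[of _ "\<lambda>x. 0"]) (auto simp: zero_blinfun.rep_eq C1_on_const)

lemma C2_on_bounded_linear:
  assumes "bounded_linear l"
  shows "C2_on U l"
  unfolding C2_on_iff_C1_on
  by (intro exI[of _ "\<lambda>x. Blinfun l"])
    (auto simp: bounded_linear_Blinfun_apply[OF assms] bounded_linear_imp_has_derivative[OF assms] C1_on_const)

lemma C2_on_add:
  assumes "C2_on U f" "C2_on U g"
  shows "C2_on U (\<lambda>x. f x + g x)"
proof -
  obtain f' where f': "\<forall>x\<in>U. (f has_derivative blinfun_apply (f' x)) (at x)" "C1_on U f'"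
    using assms(1) unfolding C2_on_iff_C1_on by blast
  obtain g' where g': "\<forall>x\<in>U. (g has_derivative blinfun_apply (g' x)) (at x)" "C1_on U g'"
    using assms(2) unfolding C2_on_iff_C1_on by blast
  have "((\<lambda>x. f x + g x) has_derivative blinfun_apply (f' x + g' x)) (at x)" if "x \<in> U" for x
    using has_derivative_add[OF bspec[OF f'(1) that] bspec[OF g'(1) that]] by (simp add: plus_blinfun.rep_eq)
  then show ?thesis
    unfolding C2_on_iff_C1_on using C1_on_add[OF f'(2) g'(2)]
    by (intro exI[of _ "\<lambda>x. f' x + g' x"]) simp
qed

lemma (in bounded_bilinear) C2_on:
  assumes "C2_on U f" "C2_on U g"
  shows "C2_on U (\<lambda>x. prod (f x) (g x))"
proof -
  obtain f' where f': "\<forall>x\<in>U. (f has_derivative blinfun_apply (f' x)) (at x)" "C1_on U f'"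
    using assms(1) unfolding C2_on_iff_C1_on by blast
  obtain g' where g': "\<forall>x\<in>U. (g has_derivative blinfun_apply (g' x)) (at x)" "C1_on U g'"
    using assms(2) unfolding C2_on_iff_C1_on by blast
  have "C1_on U (\<lambda>x. prod_right (f x))" "C1_on U (\<lambda>x. prod_left (g x))"
    by (rule C1_on_compose[OF C1_on_bounded_linear[OF bounded_linear_prod_right] _ subset_UNIV]
        C1_on_compose[OF C1_on_bounded_linear[OF bounded_linear_prod_left] _ subset_UNIV]
        assms[THEN C2_on_imp_C1_on])+
  then have "C1_on U (\<lambda>x. (prod_right (f x) o\<^sub>L g' x) + (prod_left (g x) o\<^sub>L f' x))"
    using f'(2) g'(2)
    by (intro C1_on_add bounded_bilinear.C1_on[OF bounded_bilinear_blinfun_compose])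
  moreover have "((\<lambda>x. prod (f x) (g x)) has_derivative blinfun_apply
      ((prod_right (f x) o\<^sub>L g' x) + (prod_left (g x) o\<^sub>L f' x))) (at x)" if "x \<in> U" for x
    by (rule has_derivative_blinfun[OF bspec[OF f'(1) that] bspec[OF g'(1) that]])
  ultimately show ?thesis
    unfolding C2_on_iff_C1_on
    by (intro exI[of _ "\<lambda>x. (prod_right (f x) o\<^sub>L g' x) + (prod_left (g x) o\<^sub>L f' x)"]) simp
qed

lemma C2_on_compose:
  assumes "C2_on V g" "C2_on U f" "f ` U \<subseteq> V"
  shows "C2_on U (\<lambda>x. g (f x))"
proof -
  obtain f' where f': "\<forall>x\<in>U. (f has_derivative blinfun_apply (f' x)) (at x)" "C1_on U f'"
    using assms(2) unfolding C2_on_iff_C1_on by blast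
  obtain g' where g': "\<forall>x\<in>V. (g has_derivative blinfun_apply (g' x)) (at x)" "C1_on V g'"
    using assms(1) unfolding C2_on_iff_C1_on by blast
  \<comment> \<open>The derivative of the composition is a bounded bilinear product of
    \<open>g' \<circ> f\<close> and \<open>f'\<close>, so the product rule for \<open>C1_on\<close>
    applies to it.\<close>
  have "C1_on U (\<lambda>x. g' (f x) o\<^sub>L f' x)"
    using C1_on_compose[OF g'(2) C2_on_imp_C1_on[OF assms(2)] assms(3)] f'(2)
    by (intro bounded_bilinear.C1_on[OF bounded_bilinear_blinfun_compose])
  moreover have "((\<lambda>x. g (f x)) has_derivative blinfun_apply (g' (f x) o\<^sub>L f' x)) (at x)" if "x \<in> U" for x
  proof -
    have "f x \<in> V"
      using that assms(3) by blast
    then show ?thesis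
      using has_derivative_compose[OF bspec[OF f'(1) that] bspec[OF g'(1)]] by (simp add: blinfun_compose.rep_eq o_def)
  qed
  ultimately show ?thesis
    unfolding C2_on_iff_C1_on by (intro exI[of _ "\<lambda>x. g' (f x) o\<^sub>L f' x"]) simp
qed

lemma C2_on_compose_bounded_linear:
  assumes "bounded_linear l" "C2_on U f"
  shows "C2_on U (\<lambda>x. l (f x))"
  using C2_on_compose[OF C2_on_bounded_linear[OF assms(1), of UNIV] assms(2)] by simp

text \<open>A field derivative \<open>c\<close> acts as multiplication by \<open>c\<close>, and
  \<open>blinfun_mult_right\<close> is bounded linear in \<open>c\<close>. Hence the operator-valued
  derivatives inherit the regularity of \<open>g'\<close> and \<open>g''\<close>.\<close>

lemma C2_on_field_derivative:
  fixes g :: "'a::real_normed_field \<Rightarrow> 'a"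
  assumes "\<And>x. x \<in> V \<Longrightarrow> (g has_field_derivative g' x) (at x)"
    and "\<And>x. x \<in> V \<Longrightarrow> (g' has_field_derivative g'' x) (at x)"
    and "continuous_on V g''"
  shows "C2_on V g"
  unfolding C2_on_iff_C1_on
proof (intro exI conjI ballI)
  have "continuous_on V (\<lambda>x. blinfun_mult_right (g'' x))"
    using assms(3) by (rule bounded_linear.continuous_on[OF bounded_linear_blinfun_mult_right])
  then have "C1_on V g'"
    using assms(2) unfolding C1_on_def has_field_derivative_def
    by (intro exI[of _ "\<lambda>x. blinfun_mult_right (g'' x)"]) (auto simp: blinfun_mult_right.rep_eq)
  then show "C1_on V (\<lambda>x. blinfun_mult_right (g' x))"
    by (rule C1_on_compose[OF C1_on_bounded_linear[OF bounded_linear_blinfun_mult_right] _ subset_UNIV])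
  show "(g has_derivative blinfun_apply (blinfun_mult_right (g' x))) (at x)" if "x \<in> V" for x
    using assms(1)[OF that] by (simp add: has_field_derivative_def blinfun_mult_right.rep_eq)
qed

section \<open>Twist maps\<close>

text \<open>This is \<open>sqrt (\<phi> x / x)\<close> for the profile
  \<open>\<phi> x = k * x / (1 - 2 * \<beta> * x)\<close>: the factor by which a twist stretches the
  modulus of \<open>z\<close> when \<open>x\<close> is the squared modulus. It stays smooth at
  \<open>x = 0\<close>, that is, on the axis.\<close>

definition twist_scale :: "real \<Rightarrow> real \<Rightarrow> real \<Rightarrow> real" where
  "twist_scale k \<beta> x = sqrt (k / (1 - 2 * \<beta> * x))"

definition heis_twist :: "real \<Rightarrow> real \<Rightarrow> real \<Rightarrow> heis \<Rightarrow> heis" where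
  "heis_twist k \<beta> \<alpha> p =
     (fst p * of_real (twist_scale k \<beta> ((cmod (fst p))\<^sup>2)) * exp (\<i> * of_real (\<alpha> + \<beta> * snd p)),
      k * snd p)"

lemma twist_scale_pos:
  assumes "k > 0" "2 * \<beta> * x < 1"
  shows "twist_scale k \<beta> x > 0"
  using assms by (simp add: twist_scale_def)

lemma twist_scale_sq:
  assumes "k > 0" "2 * \<beta> * x < 1"
  shows "(twist_scale k \<beta> x)\<^sup>2 = k / (1 - 2 * \<beta> * x)"
  using assms by (simp add: twist_scale_def)

text \<open>The derivative is put in the form of a logarithmic derivative times the function, so
  that differentiating again keeps this shape.\<close>

lemma has_real_derivative_twist_scale:
  assumes "k > 0" "2 * \<beta> * x < 1"
  shows "(twist_scale k \<beta> has_real_derivative \<beta> / (1 - 2 * \<beta> * x) * twist_scale k \<beta> x) (at x)"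
proof -
  let ?w = "1 - 2 * \<beta> * x"
  have w: "?w > 0" "k / ?w > 0" using assms by auto
  have "(twist_scale k \<beta> has_real_derivative
      (k * (2 * \<beta>) / ?w\<^sup>2) * (inverse (sqrt (k / ?w)) / 2)) (at x)"
    unfolding twist_scale_def[abs_def]
    using w by (auto intro!: derivative_eq_intros simp: power2_eq_square)
  moreover have "(k * (2 * \<beta>) / ?w\<^sup>2) * (inverse (sqrt (k / ?w)) / 2) = \<beta> / ?w * sqrt (k / ?w)"
  proof -
    have "(k * (2 * \<beta>) / ?w\<^sup>2) * (inverse (sqrt (k / ?w)) / 2)
        = \<beta> / ?w * ((k / ?w) * inverse (sqrt (k / ?w)))"
      by (simp add: power2_eq_square)
    also have "(k / ?w) * inverse (sqrt (k / ?w)) = sqrt (k / ?w)"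
      using w(2) real_div_sqrt[of "k / ?w"] by (simp add: divide_inverse)
    finally show ?thesis .
  qed
  ultimately show ?thesis
    by (simp add: twist_scale_def)
qed

lemma C2_on_twist_scale:
  assumes "k > 0"
  shows "C2_on {x. 2 * \<beta> * x < 1} (twist_scale k \<beta>)"
proof (rule C2_on_field_derivative)
  fix x assume "x \<in> {x. 2 * \<beta> * x < 1}"
  then have x: "2 * \<beta> * x < 1" by simp
  then have w: "1 - 2 * \<beta> * x \<noteq> 0" by simp
  show "(twist_scale k \<beta> has_real_derivative \<beta> / (1 - 2 * \<beta> * x) * twist_scale k \<beta> x) (at x)"
    by (rule has_real_derivative_twist_scale[OF assms x])
  \<comment> \<open>With \<open>s = \<beta> / (1 - 2 * \<beta> * x)\<close> and the scale
    \<open>h\<close> one has \<open>s' = 2 * s\<^sup>2\<close> and \<open>h' = s * h\<close>, so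
    \<open>(s * h)' = 3 * s\<^sup>2 * h\<close>.\<close>
  show "((\<lambda>x. \<beta> / (1 - 2 * \<beta> * x) * twist_scale k \<beta> x) has_real_derivative
      3 * (\<beta> / (1 - 2 * \<beta> * x))\<^sup>2 * twist_scale k \<beta> x) (at x)"
    by (rule derivative_eq_intros has_real_derivative_twist_scale[OF assms x] refl w)+
      (use w in \<open>simp add: power2_eq_square field_simps\<close>)
next
  have "continuous_on {x. 2 * \<beta> * x < 1} (twist_scale k \<beta>)"
    unfolding twist_scale_def[abs_def] by (auto intro!: continuous_intros)
  then show "continuous_on {x. 2 * \<beta> * x < 1} (\<lambda>x. 3 * (\<beta> / (1 - 2 * \<beta> * x))\<^sup>2 * twist_scale k \<beta> x)"
    by (auto intro!: continuous_intros)
qed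

text \<open>The last two terms of \<open>\<omega>\<close> are complex conjugates of each other, so
  the form is real.\<close>

lemma heis_form_eq: "heis_form p v = of_real (snd v + 2 * Im (cnj (fst p) * fst v))"
  by (auto simp: heis_form_def complex_eq_iff)

section \<open>Smoothness, derivative and contact identity of twists\<close>

lemma C2_on_heis_twist:
  assumes "k > 0" "\<And>p. p \<in> U \<Longrightarrow> 2 * \<beta> * (cmod (fst p))\<^sup>2 < 1"
  shows "C2_on U (heis_twist k \<beta> \<alpha>)"
proof -
  have bl: "bounded_linear (\<lambda>z::complex. (z, 0::real))" "bounded_linear (\<lambda>t::real. (0::complex, t))"
    "bounded_linear (\<lambda>x::real. of_real x :: complex)" "bounded_linear (\<lambda>p::heis. snd p)"
    "bounded_linear (\<lambda>p::heis. fst p)" "bounded_linear (\<lambda>p::heis. k * snd p)"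
    "bounded_linear (\<lambda>p::heis. \<i> * of_real (\<beta> * snd p))"
    by (intro bounded_linear_intros bounded_linear_Pair bounded_linear_ident bounded_linear_zero
      bounded_linear_compose[OF bounded_linear_of_real])+
  \<comment> \<open>The squared modulus is taken as an inner product because the modulus itself is
    not differentiable on the axis.\<close>
  have n: "C2_on U (\<lambda>p::heis. (cmod (fst p))\<^sup>2)"
    unfolding power2_norm_eq_inner
    by (intro bounded_bilinear.C2_on[OF bounded_bilinear_inner] C2_on_bounded_linear bl)
  have h: "C2_on U (\<lambda>p::heis. of_real (twist_scale k \<beta> ((cmod (fst p))\<^sup>2)) :: complex)"
    by (rule C2_on_compose_bounded_linear[OF bl(3) C2_on_compose[OF C2_on_twist_scale[OF assms(1)] n]])
      (use assms(2) in auto)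
  have "C2_on UNIV (exp :: complex \<Rightarrow> complex)"
    by (rule C2_on_field_derivative[where g'=exp and g''=exp]) (auto intro!: continuous_intros DERIV_exp)
  moreover have "C2_on U (\<lambda>p::heis. \<i> * of_real \<alpha> + \<i> * of_real (\<beta> * snd p))"
    by (intro C2_on_add C2_on_const C2_on_bounded_linear bl)
  ultimately have e: "C2_on U (\<lambda>p::heis. exp (\<i> * of_real \<alpha> + \<i> * of_real (\<beta> * snd p)))"
    by (rule C2_on_compose) simp
  have "C2_on U (\<lambda>p. (fst p * of_real (twist_scale k \<beta> ((cmod (fst p))\<^sup>2)) *
      exp (\<i> * of_real \<alpha> + \<i> * of_real (\<beta> * snd p)), 0) + (0, k * snd p))"
    by (intro C2_on_add C2_on_compose_bounded_linear[OF bl(1)] C2_on_compose_bounded_linear[OF bl(2)]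
        bounded_bilinear.C2_on[OF bounded_bilinear_mult] h e C2_on_bounded_linear bl)
  then show ?thesis
    by (simp add: heis_twist_def[abs_def] distrib_left)
qed

text \<open>The first component of the differential of a twist, factored as
  \<open>h * e * (dz + z * d (ln h) + \<i> * z * \<beta> dt)\<close> with the scale \<open>h\<close>
  and the rotation \<open>e\<close>. Of the common factor only \<open>h\<^sup>2\<close> survives in
  the contact form, and it cancels from the Beltrami equation.\<close>

definition heis_twist_D1 :: "real \<Rightarrow> real \<Rightarrow> real \<Rightarrow> heis \<Rightarrow> heis \<Rightarrow> complex" where
  "heis_twist_D1 k \<beta> \<alpha> p v =
     (let z = fst p; x = (cmod z)\<^sup>2 in
      of_real (twist_scale k \<beta> x) * exp (\<i> * of_real (\<alpha> + \<beta> * snd p)) *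
      (fst v + z * of_real (2 * \<beta> / (1 - 2 * \<beta> * x) * Re (cnj z * fst v)) + \<i> * z * of_real (\<beta> * snd v)))"

lemma has_derivative_cmod_fst_sq:
  "((\<lambda>p::heis. (cmod (fst p))\<^sup>2) has_derivative (\<lambda>v. 2 * Re (cnj (fst p) * fst v))) (at p)"
proof -
  have "((\<lambda>p::heis. inner (fst p) (fst p)) has_derivative (\<lambda>v. 2 * Re (cnj (fst p) * fst v))) (at p)"
    by (auto intro!: derivative_eq_intros simp: inner_complex_def algebra_simps)
  then show ?thesis
    by (simp add: power2_norm_eq_inner)
qed

lemma has_derivative_heis_twist_fst:
  assumes "k > 0" "2 * \<beta> * (cmod (fst p))\<^sup>2 < 1"
  shows "((\<lambda>p. fst (heis_twist k \<beta> \<alpha> p)) has_derivative heis_twist_D1 k \<beta> \<alpha> p) (at p)"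
proof -
  have h: "((\<lambda>p::heis. twist_scale k \<beta> ((cmod (fst p))\<^sup>2)) has_derivative
      (\<lambda>v. \<beta> / (1 - 2 * \<beta> * (cmod (fst p))\<^sup>2) * twist_scale k \<beta> ((cmod (fst p))\<^sup>2) *
        (2 * Re (cnj (fst p) * fst v)))) (at p)"
    using has_derivative_compose[OF has_derivative_cmod_fst_sq
        has_real_derivative_twist_scale[OF assms, unfolded has_field_derivative_def]] by simp
  have e: "((\<lambda>p::heis. exp (\<i> * of_real (\<alpha> + \<beta> * snd p))) has_derivative
      (\<lambda>v. exp (\<i> * of_real (\<alpha> + \<beta> * snd p)) * (\<i> * of_real (\<beta> * snd v)))) (at p)"
    by (rule has_derivative_compose[OF _ DERIV_exp[unfolded has_field_derivative_def]])
      (auto intro!: derivative_eq_intros)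
  show ?thesis
    unfolding heis_twist_def fst_conv
    by (rule has_derivative_eq_rhs[OF has_derivative_mult[OF has_derivative_mult[OF
              has_derivative_fst[OF has_derivative_ident] has_derivative_of_real[OF h]] e]])
      (auto simp: heis_twist_D1_def Let_def fun_eq_iff algebra_simps)
qed

text \<open>With \<open>F = z * h * e\<close>, the derivative of \<open>h\<close> contributes only a
  real term to \<open>cnj F * dF\<close>, so the form sees only \<open>dz\<close> and the rotation.
  Since \<open>k = h\<^sup>2 * (1 - 2 * \<beta> * x)\<close>, the rotation term
  \<open>2 * h\<^sup>2 * x * \<beta> dt\<close> completes \<open>k dt\<close> to
  \<open>h\<^sup>2 dt\<close>, which makes the pullback a multiple of
  \<open>\<omega>\<close>.\<close>

lemma heis_twist_contact:
  assumes "k > 0" "2 * \<beta> * (cmod (fst p))\<^sup>2 < 1"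
  shows "heis_form (heis_twist k \<beta> \<alpha> p) (heis_twist_D1 k \<beta> \<alpha> p v, k * snd v)
    = of_real ((twist_scale k \<beta> ((cmod (fst p))\<^sup>2))\<^sup>2) * heis_form p v"
proof -
  define z w x where "z = fst p" and "w = fst v" and "x = (cmod z)\<^sup>2"
  define h e where "h = twist_scale k \<beta> x"
    and "e = exp (\<i> * of_real (\<alpha> + \<beta> * snd p))"
  have e: "cnj e * e = 1"
    by (simp add: e_def exp_cnj flip: exp_add)
  have k: "k = h\<^sup>2 * (1 - 2 * \<beta> * x)"
    using twist_scale_sq[OF assms] assms by (simp add: h_def x_def z_def)
  have zz: "cnj z * z = of_real x"
    unfolding x_def complex_norm_square by (simp add: mult.commute)
  have "cnj (fst (heis_twist k \<beta> \<alpha> p)) * heis_twist_D1 k \<beta> \<alpha> p v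
      = cnj (z * h * e) * (h * e * (w + z * of_real (2 * \<beta> / (1 - 2 * \<beta> * x) * Re (cnj z * w))
        + \<i> * z * of_real (\<beta> * snd v)))"
    by (simp add: heis_twist_D1_def heis_twist_def Let_def z_def h_def x_def e_def w_def)
  also have "\<dots> = (cnj e * e) * of_real (h\<^sup>2) * (cnj z * w
        + (cnj z * z) * of_real (2 * \<beta> / (1 - 2 * \<beta> * x) * Re (cnj z * w))
        + \<i> * (cnj z * z) * of_real (\<beta> * snd v))"
    by (simp add: algebra_simps power2_eq_square)
  also have "Im \<dots> = h\<^sup>2 * (Im (cnj z * w) + x * \<beta> * snd v)"
    unfolding e zz by simp
  finally have "Im (cnj (fst (heis_twist k \<beta> \<alpha> p)) * heis_twist_D1 k \<beta> \<alpha> p v)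
      = h\<^sup>2 * (Im (cnj z * w) + x * \<beta> * snd v)" .
  then have "heis_form (heis_twist k \<beta> \<alpha> p) (heis_twist_D1 k \<beta> \<alpha> p v, k * snd v)
      = of_real (h\<^sup>2 * (1 - 2 * \<beta> * x) * snd v + 2 * (h\<^sup>2 * (Im (cnj z * w) + x * \<beta> * snd v)))"
    unfolding heis_form_eq fst_conv snd_conv using k by metis
  also have "h\<^sup>2 * (1 - 2 * \<beta> * x) * snd v + 2 * (h\<^sup>2 * (Im (cnj z * w) + x * \<beta> * snd v))
      = h\<^sup>2 * (snd v + 2 * Im (cnj z * w))"
    by (simp only: algebra_simps)
  finally show ?thesis
    by (simp add: heis_form_eq z_def w_def h_def x_def)
qed

section \<open>Profile, dilatation and Beltrami equations of twists\<close>

lemma cmod_heis_twist_fst_sq: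
  assumes "k > 0" "2 * \<beta> * (cmod (fst p))\<^sup>2 < 1"
  shows "(cmod (fst (heis_twist k \<beta> \<alpha> p)))\<^sup>2
    = k * (cmod (fst p))\<^sup>2 / (1 - 2 * \<beta> * (cmod (fst p))\<^sup>2)"
  using twist_scale_sq[OF assms] by (simp add: heis_twist_def norm_mult power_mult_distrib)

text \<open>The Beltrami coefficient of a twist, obtained by simplifying
  \<open>Zbar f1 / Z f1\<close>. The denominator is at least \<open>1/2\<close> for every
  \<open>z\<close>, so this is a continuous function on the whole plane.\<close>

definition twist_dilatation :: "real \<Rightarrow> complex \<Rightarrow> complex" where
  "twist_dilatation \<beta> z = (let y = \<beta> * (cmod z)\<^sup>2 in
     of_real (2 * \<beta> * (1 - y) / (1 - 2 * y * (1 - y))) * z\<^sup>2)"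

lemma two_mult_one_minus_le_half: "2 * y * (1 - y) \<le> (1/2 :: real)"
  using zero_le_power2[of "2 * y - 1"] by (simp add: power2_eq_square algebra_simps)

text \<open>One finds \<open>Z f1 = c * (1 + s * x - \<beta> * x)\<close> and
  \<open>Zbar f1 = c * (s + \<beta>) * z\<^sup>2\<close>, and \<open>1 - 2 * \<beta> * x\<close>
  cancels from the quotient. Only the differential at \<open>p\<close> enters, so the lemma serves
  for any map that agrees with a twist near \<open>p\<close>.\<close>

lemma heis_twist_beltrami_fst:
  assumes "2 * \<beta> * (cmod (fst p))\<^sup>2 < 1"
    and D: "(f has_derivative heis_twist_D1 k \<beta> \<alpha> p) (at p)"
  shows "heis_Zbar f p = twist_dilatation \<beta> (fst p) * heis_Z f p"
proof -
  define z x c where "z = fst p" and "x = (cmod z)\<^sup>2"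
    and "c = of_real (twist_scale k \<beta> x) * exp (\<i> * of_real (\<alpha> + \<beta> * snd p))"
  define s where "s = \<beta> / (1 - 2 * \<beta> * x)"
  define u where "u = 2 * (\<beta> * x) * (1 - \<beta> * x)"
  have x: "1 - 2 * \<beta> * x > 0" using assms by (simp add: x_def z_def)
  have u: "1 - u > 0" using two_mult_one_minus_le_half[of "\<beta> * x"] by (simp add: u_def)
  have zz: "cnj z * z = of_real x" "z * cnj z = of_real x"
    unfolding x_def complex_norm_square by (simp_all add: mult.commute)
  have fd: "frechet_derivative f (at p) = (\<lambda>v. c * (fst v + z * of_real (2 * s * Re (cnj z * fst v))
      + \<i> * z * of_real (\<beta> * snd v)))"
    using frechet_derivative_at[OF D, symmetric]
    by (simp add: heis_twist_D1_def Let_def c_def s_def x_def z_def fun_eq_iff)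
  have td: "twist_dilatation \<beta> z = of_real (2 * \<beta> * (1 - \<beta> * x) / (1 - u)) * z\<^sup>2"
    by (simp add: twist_dilatation_def Let_def x_def u_def)
  \<comment> \<open>These combinations appear because \<open>Re (cnj z * v)\<close> is
    \<open>Re z\<close> for \<open>v = 1\<close> and \<open>Im z\<close> for
    \<open>v = \<i>\<close>.\<close>
  have zdec: "of_real (Re z) - \<i> * of_real (Im z) = cnj z" "of_real (Re z) + \<i> * of_real (Im z) = z"
    by (auto simp: complex_eq_iff)
  have "heis_Z f p = c * (1 + s * (z * (of_real (Re z) - \<i> * of_real (Im z))) - \<beta> * (cnj z * z))"
    by (simp add: heis_Z_def Let_def fd field_simps flip: z_def)
  then have 1: "heis_Z f p = c * of_real (1 + s * x - \<beta> * x)"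
    unfolding zdec zz by simp
  have "heis_Zbar f p = c * (s * z * (of_real (Re z) + \<i> * of_real (Im z)) + \<beta> * z * z)"
    by (simp add: heis_Zbar_def Let_def fd field_simps flip: z_def)
  then have 2: "heis_Zbar f p = c * (of_real (s + \<beta>) * z\<^sup>2)"
    unfolding zdec by (simp add: algebra_simps power2_eq_square)
  have "1 + s * x - \<beta> * x = (1 - u) / (1 - 2 * \<beta> * x)"
    using x by (simp add: s_def u_def field_simps)
  moreover have "s + \<beta> = 2 * \<beta> * (1 - \<beta> * x) / (1 - 2 * \<beta> * x)"
    using x by (simp add: s_def field_simps)
  ultimately have "s + \<beta> = 2 * \<beta> * (1 - \<beta> * x) / (1 - u) * (1 + s * x - \<beta> * x)"
    using u x by simp
  then have "of_real (s + \<beta>) * z\<^sup>2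
      = (of_real (2 * \<beta> * (1 - \<beta> * x) / (1 - u)) * of_real (1 + s * x - \<beta> * x)) * z\<^sup>2"
    by (simp only: of_real_mult[symmetric])
  then have "of_real (s + \<beta>) * z\<^sup>2 = twist_dilatation \<beta> z * of_real (1 + s * x - \<beta> * x)"
    unfolding td by (simp only: mult_ac)
  then show ?thesis
    unfolding 1 2 z_def[symmetric] by simp
qed

text \<open>The differential is that of \<open>k * t + \<i> * \<phi> x\<close>, so
  \<open>Z h = \<i> * (m + k) * cnj z\<close> and \<open>Zbar h = \<i> * (m - k) * z\<close>, where
  \<open>m\<close> is the slope of the profile. The same coefficient serves both equations because
  \<open>1 - 2 * u\<close> is the square of \<open>1 - 2 * \<beta> * x\<close>: this gives
  \<open>m * (1 - 2 * u) = k\<close>, hence \<open>(m - k) * (1 - u) = u * (m + k)\<close>.\<close>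

lemma heis_twist_beltrami_snd:
  assumes "2 * \<beta> * (cmod (fst p))\<^sup>2 < 1"
    and D: "(h has_derivative (\<lambda>v. of_real (k * snd v) + \<i> * of_real
      (k / (1 - 2 * \<beta> * (cmod (fst p))\<^sup>2)\<^sup>2 * (2 * Re (cnj (fst p) * fst v))))) (at p)"
  shows "heis_Zbar h p = twist_dilatation \<beta> (fst p) * heis_Z h p"
proof -
  define z x where "z = fst p" and "x = (cmod z)\<^sup>2"
  define m where "m = k / (1 - 2 * \<beta> * x)\<^sup>2"
  define u where "u = 2 * (\<beta> * x) * (1 - \<beta> * x)"
  have x: "1 - 2 * \<beta> * x > 0" using assms by (simp add: x_def z_def)
  have u: "1 - u > 0" using two_mult_one_minus_le_half[of "\<beta> * x"] by (simp add: u_def)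
  have zz: "z * cnj z = of_real x"
    unfolding x_def complex_norm_square by (simp_all add: mult.commute)
  have fd: "frechet_derivative h (at p) = (\<lambda>v. of_real (k * snd v) + \<i> * of_real (m * (2 * Re (cnj z * fst v))))"
    using frechet_derivative_at[OF D, symmetric]
    by (simp add: m_def x_def z_def fun_eq_iff)
  have td: "twist_dilatation \<beta> z = of_real (2 * \<beta> * (1 - \<beta> * x) / (1 - u)) * z\<^sup>2"
    by (simp add: twist_dilatation_def Let_def x_def u_def)
  have zdec: "of_real (Re z) - \<i> * of_real (Im z) = cnj z" "of_real (Re z) + \<i> * of_real (Im z) = z"
    by (auto simp: complex_eq_iff)
  have "heis_Z h p = \<i> * of_real m * (of_real (Re z) - \<i> * of_real (Im z)) + \<i> * cnj z * of_real k"
    by (simp add: heis_Z_def Let_def fd field_simps flip: z_def)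
  then have 1: "heis_Z h p = \<i> * of_real (m + k) * cnj z"
    unfolding zdec by (simp add: algebra_simps)
  have "heis_Zbar h p = \<i> * of_real m * (of_real (Re z) + \<i> * of_real (Im z)) - \<i> * z * of_real k"
    by (simp add: heis_Zbar_def Let_def fd field_simps flip: z_def)
  then have 2: "heis_Zbar h p = \<i> * of_real (m - k) * z"
    unfolding zdec by (simp add: algebra_simps)
  have "1 - 2 * u = (1 - 2 * \<beta> * x)\<^sup>2"
    by (simp add: u_def power2_eq_square algebra_simps)
  then have "m * (1 - 2 * u) = k"
    using x by (simp add: m_def)
  then have "(m - k) * (1 - u) = u * (m + k)"
    by (auto simp: algebra_simps)
  then have "m - k = u / (1 - u) * (m + k)"
    using u by (simp add: field_simps)
  then have mk: "of_real (m - k) = (of_real (u / (1 - u)) * of_real (m + k) :: complex)"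
    by (simp only: of_real_mult[symmetric])
  have "twist_dilatation \<beta> z * cnj z = of_real (2 * \<beta> * (1 - \<beta> * x) / (1 - u)) * z * (z * cnj z)"
    unfolding td power2_eq_square by (simp only: mult_ac)
  then have tz: "twist_dilatation \<beta> z * cnj z = of_real (u / (1 - u)) * z"
    unfolding zz u_def by (simp add: algebra_simps)
  have "\<i> * of_real (m - k) * z = \<i> * of_real (m + k) * (of_real (u / (1 - u)) * z)"
    unfolding mk by (simp only: mult_ac)
  also have "\<dots> = twist_dilatation \<beta> z * (\<i> * of_real (m + k) * cnj z)"
    unfolding tz[symmetric] by (simp only: mult_ac)
  finally show ?thesis
    unfolding 1 2 z_def[symmetric] .
qed

lemma Im_of_real_mult: "Im (of_real c * w) = c * Im w"
  by simp

text \<open>If \<open>y = k * x / (1 - 2 * \<beta> * x)\<close> is the new squared modulus, then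
  \<open>1 + 2 * (\<beta> / k) * y = 1 / (1 - 2 * \<beta> * x)\<close>, so the radial factors are
  reciprocal. The angles cancel because the height \<open>t\<close> has become
  \<open>k * t\<close>.\<close>

lemma heis_twist_inverse:
  assumes "k > 0" "2 * \<beta> * (cmod (fst p))\<^sup>2 < 1"
  shows "heis_twist (1 / k) (- \<beta> / k) (- \<alpha>) (heis_twist k \<beta> \<alpha> p) = p"
proof -
  define x where "x = (cmod (fst p))\<^sup>2"
  have x: "1 - 2 * \<beta> * x > 0" using assms by (simp add: x_def)
  have "1 - 2 * (- \<beta> / k) * (k * x / (1 - 2 * \<beta> * x)) = 1 / (1 - 2 * \<beta> * x)"
    using assms(1) x by (simp add: field_simps)
  then have "twist_scale (1 / k) (- \<beta> / k) (k * x / (1 - 2 * \<beta> * x)) = sqrt ((1 / k) / (1 / (1 - 2 * \<beta> * x)))"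
    unfolding twist_scale_def by simp
  also have "\<dots> = 1 / twist_scale k \<beta> x"
    by (simp add: twist_scale_def real_sqrt_divide)
  finally have "twist_scale k \<beta> x * twist_scale (1 / k) (- \<beta> / k) ((cmod (fst (heis_twist k \<beta> \<alpha> p)))\<^sup>2) = 1"
    using twist_scale_pos[OF assms] by (simp add: cmod_heis_twist_fst_sq[OF assms] x_def)
  then have s: "complex_of_real (twist_scale k \<beta> x) *
      of_real (twist_scale (1 / k) (- \<beta> / k) ((cmod (fst (heis_twist k \<beta> \<alpha> p)))\<^sup>2)) = 1"
    by (metis of_real_1 of_real_mult)
  have e: "exp (\<i> * of_real (\<alpha> + \<beta> * snd p)) * exp (\<i> * of_real (- \<alpha> + - \<beta> / k * (k * snd p))) = 1"
    using assms(1) by (simp add: algebra_simps flip: exp_add)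
  have "fst (heis_twist (1 / k) (- \<beta> / k) (- \<alpha>) (heis_twist k \<beta> \<alpha> p))
      = fst p * (of_real (twist_scale k \<beta> x) *
          of_real (twist_scale (1 / k) (- \<beta> / k) ((cmod (fst (heis_twist k \<beta> \<alpha> p)))\<^sup>2))) *
        (exp (\<i> * of_real (\<alpha> + \<beta> * snd p)) * exp (\<i> * of_real (- \<alpha> + - \<beta> / k * (k * snd p))))"
    unfolding heis_twist_def fst_conv snd_conv x_def by (simp only: mult_ac)
  then have "fst (heis_twist (1 / k) (- \<beta> / k) (- \<alpha>) (heis_twist k \<beta> \<alpha> p)) = fst p"
    unfolding s e by simp
  moreover have "snd (heis_twist (1 / k) (- \<beta> / k) (- \<alpha>) (heis_twist k \<beta> \<alpha> p)) = snd p"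
    using assms(1) by (simp add: heis_twist_def)
  ultimately show ?thesis
    by (simp add: prod_eq_iff)
qed

section \<open>Images of cylinders under twists\<close>

lemma cyl_iff: "b > 0 \<Longrightarrow> p \<in> cyl a b \<longleftrightarrow> 0 < snd p \<and> snd p < a \<and> (cmod (fst p))\<^sup>2 < b"
  using real_sqrt_less_iff[of "(cmod (fst p))\<^sup>2" b] by (cases p) (simp add: cyl_def)

lemma cyl_eq_Times: "cyl r R = ball 0 (sqrt R) \<times> {0<..<r}"
  by (auto simp: cyl_def)

lemma open_cyl: "open (cyl r R)"
  unfolding cyl_eq_Times by (intro open_Times) auto

lemma convex_cyl: "convex (cyl r R)"
  unfolding cyl_eq_Times by (intro convex_Times) auto

lemma heis_domain_cyl:
  assumes "r > 0" "R > 0"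
  shows "heis_domain (cyl r R)"
  using assms open_cyl convex_connected[OF convex_cyl]
  by (auto simp: heis_domain_def cyl_eq_Times)

text \<open>The bound has to cover both signs of \<open>\<beta>\<close>, since inverting a twist
  turns the rate into \<open>- \<beta> / k\<close>.\<close>

lemma twist_mult_less_one:
  fixes \<beta> b x :: real
  assumes "2 * \<beta> * b < 1" "0 \<le> x" "x \<le> b"
  shows "2 * \<beta> * x < 1"
proof (cases "\<beta> \<ge> 0")
  case True
  then have "2 * \<beta> * x \<le> 2 * \<beta> * b" using assms by (intro mult_left_mono) auto
  then show ?thesis using assms by simp
next
  case False
  then have "2 * \<beta> * x \<le> 0" using assms by (simp add: mult_nonpos_nonneg)
  then show ?thesis by simp
qed

lemma heis_twist_in_cyl:
  assumes "k > 0" "b > 0" "2 * \<beta> * b < 1" "p \<in> cyl a b"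
  shows "heis_twist k \<beta> \<alpha> p \<in> cyl (k * a) (k * b / (1 - 2 * \<beta> * b))"
proof -
  define x where "x = (cmod (fst p))\<^sup>2"
  have x: "0 \<le> x" "x < b" "0 < snd p" "snd p < a"
    using assms(4) cyl_iff[OF assms(2)] by (auto simp: x_def)
  have x1: "2 * \<beta> * x < 1"
    using twist_mult_less_one[OF assms(3)] x by simp
  \<comment> \<open>Cross-multiplied form of the strict monotonicity of the profile; the mixed terms
    cancel and leave \<open>x < b\<close>.\<close>
  have "x * (1 - 2 * \<beta> * b) < b * (1 - 2 * \<beta> * x)"
    using x by (simp add: algebra_simps)
  then have "k * x / (1 - 2 * \<beta> * x) < k * b / (1 - 2 * \<beta> * b)"
    using assms x1 by (simp add: field_simps)
  moreover have "k * b / (1 - 2 * \<beta> * b) > 0"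
    using assms by simp
  ultimately show ?thesis
    using x assms(1) cmod_heis_twist_fst_sq[of k \<beta> p \<alpha>] x1
    by (simp add: cyl_iff x_def) (simp add: heis_twist_def)
qed

lemma homeomorphism_heis_twist:
  assumes "k > 0" "b > 0" "2 * \<beta> * b < 1"
  shows "homeomorphism (cyl a b) (cyl (k * a) (k * b / (1 - 2 * \<beta> * b)))
    (heis_twist k \<beta> \<alpha>) (heis_twist (1 / k) (- \<beta> / k) (- \<alpha>))"
proof -
  define b' where "b' = k * b / (1 - 2 * \<beta> * b)"
  have w: "1 - 2 * \<beta> * b > 0" using assms by simp
  have b': "b' > 0" using assms by (simp add: b'_def)
  \<comment> \<open>This positive value makes the inverse twist regular on the image cylinder, so
    that \<open>heis_twist_in_cyl\<close> can be applied in the other direction as well.\<close>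
  have w': "1 - 2 * (- \<beta> / k) * b' = 1 / (1 - 2 * \<beta> * b)"
    using assms(1) w by (simp add: b'_def field_simps)
  have "1 / (1 - 2 * \<beta> * b) > 0" using w by simp
  then have less: "2 * (- \<beta> / k) * b' < 1" using w' by linarith
  have b: "1 / k * b' / (1 - 2 * (- \<beta> / k) * b') = b"
    unfolding w' using assms(1) w by (simp add: b'_def)
  have 1: "2 * \<beta> * (cmod (fst p))\<^sup>2 < 1" if "p \<in> cyl a b" for p
    using twist_mult_less_one[OF assms(3)] that cyl_iff[OF assms(2)] by auto
  have 2: "2 * (- \<beta> / k) * (cmod (fst p))\<^sup>2 < 1" if "p \<in> cyl (k * a) b'" for p
    using twist_mult_less_one[OF less] that cyl_iff[OF b'] by auto
  have inv': "heis_twist k \<beta> \<alpha> (heis_twist (1 / k) (- \<beta> / k) (- \<alpha>) p) = p" if "p \<in> cyl (k * a) b'" for p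
    using heis_twist_inverse[of "1 / k" "- \<beta> / k" p "- \<alpha>"] 2[OF that] assms(1) by simp
  have im': "heis_twist (1 / k) (- \<beta> / k) (- \<alpha>) p \<in> cyl a b" if "p \<in> cyl (k * a) b'" for p
    using heis_twist_in_cyl[OF _ b' less that, of "1 / k" "- \<alpha>"] assms(1) unfolding b by simp
  have im: "heis_twist k \<beta> \<alpha> p \<in> cyl (k * a) b'" if "p \<in> cyl a b" for p
    using heis_twist_in_cyl[OF assms that] by (simp add: b'_def)
  have "continuous_on (cyl a b) (heis_twist k \<beta> \<alpha>)"
    using C2_on_heis_twist[OF assms(1) 1] C2_on_imp_C1_on C1_on_imp_continuous_on by blast
  moreover have "continuous_on (cyl (k * a) b') (heis_twist (1 / k) (- \<beta> / k) (- \<alpha>))"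
    by (rule C1_on_imp_continuous_on, rule C2_on_imp_C1_on, rule C2_on_heis_twist)
      (use assms(1) 2 in auto)
  ultimately show ?thesis
    unfolding b'_def[symmetric]
    using im im' inv' heis_twist_inverse[OF assms(1) 1]
    by (auto simp: homeomorphism_def intro!: image_eqI)
qed

section \<open>Heisenberg distance and distortion of twists\<close>

lemma heis_dist_eq:
  "heis_dist p q = root 4 (cmod (fst q - fst p) ^ 4
     + (snd q - snd p - 2 * Im (fst p * cnj (fst q)))\<^sup>2)"
  by (simp add: heis_dist_def heis_norm_def heis_mult_def heis_inv_def algebra_simps)

text \<open>Together with \<open>heis_dist_le\<close> this reduces a Lipschitz estimate to two
  bounds: the horizontal displacement is controlled linearly and the twisted height difference
  quadratically in the distance.\<close>

lemma heis_dist_ge: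
  shows "cmod (fst q - fst p) \<le> heis_dist p q"
    and "\<bar>snd q - snd p - 2 * Im (fst p * cnj (fst q))\<bar> \<le> (heis_dist p q)\<^sup>2"
proof -
  define w \<tau> where "w = cmod (fst q - fst p)" and "\<tau> = snd q - snd p - 2 * Im (fst p * cnj (fst q))"
  have d: "heis_dist p q = root 4 (w ^ 4 + \<tau>\<^sup>2)"
    by (simp add: heis_dist_eq w_def \<tau>_def)
  have "w = root 4 (w ^ 4)"
    by (simp add: w_def real_root_power_cancel)
  also have "\<dots> \<le> heis_dist p q"
    unfolding d by (intro real_root_le_mono) auto
  finally show "w \<le> heis_dist p q" .
  have "(heis_dist p q) ^ 4 = w ^ 4 + \<tau>\<^sup>2"
    unfolding d by (intro real_root_pow_pos2) (auto simp: w_def)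
  then have "\<tau>\<^sup>2 \<le> ((heis_dist p q)\<^sup>2)\<^sup>2"
    by (simp add: w_def)
  then show "\<bar>\<tau>\<bar> \<le> (heis_dist p q)\<^sup>2"
    by (intro abs_le_square_iff[THEN iffD2, of _ "(heis_dist p q)\<^sup>2", simplified abs_power2])
qed

text \<open>Since \<open>c \<ge> 1\<close>, the square of \<open>c * r\<^sup>2\<close> is at most
  \<open>(c * r) ^ 4\<close>; the factor 2 absorbs the sum of two such terms, as
  \<open>2 \<le> 2 ^ 4\<close>.\<close>

lemma heis_dist_le:
  assumes "c \<ge> 1" "r \<ge> 0" "cmod (fst q - fst p) \<le> c * r"
    and "\<bar>snd q - snd p - 2 * Im (fst p * cnj (fst q))\<bar> \<le> c * r\<^sup>2"
  shows "heis_dist p q \<le> 2 * c * r"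
proof -
  have "cmod (fst q - fst p) ^ 4 \<le> (c * r) ^ 4"
    using assms by (intro power_mono) auto
  moreover have "(snd q - snd p - 2 * Im (fst p * cnj (fst q)))\<^sup>2 \<le> (c * r\<^sup>2)\<^sup>2"
    using assms(4) by (rule abs_le_square_iff[THEN iffD1, OF order_trans]) simp
  moreover have "(c * r\<^sup>2)\<^sup>2 \<le> (c * r) ^ 4"
  proof -
    have "c\<^sup>2 * r ^ 4 \<le> c ^ 4 * r ^ 4"
      using assms by (intro mult_right_mono power_increasing) auto
    then show ?thesis by (simp add: power_mult_distrib)
  qed
  moreover have "2 * (c * r) ^ 4 \<le> (2 * c * r) ^ 4"
    using assms by (simp add: power_mult_distrib)
  ultimately have "heis_dist p q \<le> root 4 ((2 * c * r) ^ 4)"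
    unfolding heis_dist_eq by (intro real_root_le_mono) auto
  also have "\<dots> = 2 * c * r"
    using assms by (intro real_root_power_cancel) auto
  finally show ?thesis .
qed

lemma heis_dist_nonneg: "heis_dist p q \<ge> 0"
  by (simp add: heis_dist_eq)

lemma cmod_iexp_minus_one_le: "cmod (exp (\<i> * of_real u) - 1) \<le> \<bar>u\<bar>"
  using iexp_approx1[of u 0] by simp

lemma cmod_iexp_minus_linear_le: "cmod (exp (\<i> * of_real u) - 1 - \<i> * of_real u) \<le> u\<^sup>2"
proof -
  have "cmod (exp (\<i> * of_real u) - 1 - \<i> * of_real u) \<le> \<bar>u\<bar>\<^sup>2 / 2"
    using iexp_approx1[of u 1] by (simp add: algebra_simps power2_eq_square)
  also have "\<dots> \<le> u\<^sup>2" by simp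
  finally show ?thesis .
qed

text \<open>The scale and its derivative are continuous on the compact interval
  \<open>{0..b}\<close>; the mean value inequality turns the bound of the derivative into the
  Lipschitz constant.\<close>

lemma twist_scale_bounds:
  assumes "k > 0" "2 * \<beta> * b < 1"
  obtains H L where "H \<ge> 0" "L \<ge> 0" "\<And>x. x \<in> {0..b} \<Longrightarrow> twist_scale k \<beta> x \<le> H"
    "\<And>x y. x \<in> {0..b} \<Longrightarrow> y \<in> {0..b} \<Longrightarrow> \<bar>twist_scale k \<beta> x - twist_scale k \<beta> y\<bar> \<le> L * \<bar>x - y\<bar>"
proof -
  have w: "2 * \<beta> * x < 1" if "x \<in> {0..b}" for x
    using twist_mult_less_one[OF assms(2)] that by auto
  have w': "1 - 2 * \<beta> * x \<noteq> 0" if "x \<in> {0..b}" for x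
    using w[OF that] by auto
  have c: "continuous_on {0..b} (twist_scale k \<beta>)"
    unfolding twist_scale_def[abs_def] using w' by (auto intro!: continuous_intros)
  have c': "continuous_on {0..b} (\<lambda>x. \<beta> / (1 - 2 * \<beta> * x) * twist_scale k \<beta> x)"
    using w' by (intro continuous_intros c) auto
  obtain H where H: "H \<ge> 0" "\<And>x. x \<in> {0..b} \<Longrightarrow> norm (twist_scale k \<beta> x) \<le> H"
    using continuous_on_compact_bound[OF compact_Icc c] by blast
  obtain L where L: "L \<ge> 0" "\<And>x. x \<in> {0..b} \<Longrightarrow> norm (\<beta> / (1 - 2 * \<beta> * x) * twist_scale k \<beta> x) \<le> L"
    using continuous_on_compact_bound[OF compact_Icc c'] by blast
  have "norm (twist_scale k \<beta> x - twist_scale k \<beta> y) \<le> L * norm (x - y)"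
    if "x \<in> {0..b}" "y \<in> {0..b}" for x y
    by (rule field_differentiable_bound[OF convex_real_interval(5)
          DERIV_subset[OF has_real_derivative_twist_scale[OF assms(1) w]] L(2) that(1) that(2)]) auto
  then show ?thesis
    using that[OF H(1) L(1)] H(2) by (fastforce simp: abs_le_iff)
qed

text \<open>The height difference of the images could a priori change at first order in
  \<open>r = heis_dist p q\<close>. Its first-order terms cancel through
  \<open>k = h\<^sup>2 * (1 - 2 * \<beta> * x)\<close>, the identity behind contactness, and what
  remains is a sum of three terms of order \<open>r\<^sup>2\<close>. The bound is local:
  \<open>r \<le> 1\<close> serves to estimate the plain height difference linearly.\<close>

lemma heis_twist_lipschitz:
  assumes "k > 0" "b > 0" "2 * \<beta> * b < 1"
  obtains C where "C > 0" "\<And>p q. (cmod (fst p))\<^sup>2 \<le> b \<Longrightarrow> (cmod (fst q))\<^sup>2 \<le> b \<Longrightarrow> heis_dist p q \<le> 1 \<Longrightarrow>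
    heis_dist (heis_twist k \<beta> \<alpha> p) (heis_twist k \<beta> \<alpha> q) \<le> C * heis_dist p q"
proof -
  obtain H L where H: "H \<ge> 0" "\<And>x. x \<in> {0..b} \<Longrightarrow> twist_scale k \<beta> x \<le> H"
    and L: "L \<ge> 0" "\<And>x y. x \<in> {0..b} \<Longrightarrow> y \<in> {0..b} \<Longrightarrow>
      \<bar>twist_scale k \<beta> x - twist_scale k \<beta> y\<bar> \<le> L * \<bar>x - y\<bar>"
    using twist_scale_bounds[OF assms(1,3)] by metis
  \<comment> \<open>\<open>B\<close> bounds the moduli, \<open>E * r\<close> the change of the angle
    and \<open>M * r\<close> the change of the scale; \<open>c1\<close> and \<open>c2\<close>
    collect the coefficients that come out for the horizontal and the vertical part.\<close>
  define B where "B = sqrt b"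
  define E where "E = \<bar>\<beta>\<bar> * (1 + 2 * B)"
  define M where "M = L * (2 * B)"
  define c1 where "c1 = H + B * M + B * H * E"
  define c2 where "c2 = H\<^sup>2 + 2 * H\<^sup>2 * (B\<^sup>2 * E\<^sup>2 + E * B) + 2 * (H * M) * (B + B\<^sup>2 * E)"
  have nn: "B \<ge> 0" "E \<ge> 0" "M \<ge> 0" "c1 \<ge> 0" "c2 \<ge> 0"
    using assms(2) H(1) L(1) by (auto simp: B_def E_def M_def c1_def c2_def)
  have "heis_dist (heis_twist k \<beta> \<alpha> p) (heis_twist k \<beta> \<alpha> q) \<le> 2 * (1 + c1 + c2) * heis_dist p q"
    if pb: "(cmod (fst p))\<^sup>2 \<le> b" and qb: "(cmod (fst q))\<^sup>2 \<le> b" and r1: "heis_dist p q \<le> 1" for p q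
  proof -
    define r z z' \<delta> where "r = heis_dist p q" and "z = fst p" and "z' = fst q" and "\<delta> = snd q - snd p"
    define x x' h h' w u where "x = (cmod z)\<^sup>2" and "x' = (cmod z')\<^sup>2" and "h = twist_scale k \<beta> x"
      and "h' = twist_scale k \<beta> x'" and "w = z' - z" and "u = z * cnj z'"
    define e \<epsilon> where "e = exp (\<i> * of_real (\<alpha> + \<beta> * snd p))" and "\<epsilon> = exp (\<i> * of_real (\<beta> * \<delta>))"
    define \<tau> where "\<tau> = \<delta> - 2 * Im u"
    have r: "0 \<le> r" "r \<le> 1" "cmod w \<le> r" "\<bar>\<tau>\<bar> \<le> r\<^sup>2"
      using r1 heis_dist_nonneg heis_dist_ge[of q p]
      by (auto simp: r_def w_def z_def z'_def \<tau>_def \<delta>_def u_def)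
    have zB: "cmod z \<le> B" "cmod z' \<le> B"
      using pb qb by (auto simp: B_def z_def z'_def real_le_rsqrt)
    have xb: "x \<in> {0..b}" "x' \<in> {0..b}"
      using pb qb by (auto simp: x_def x'_def z_def z'_def)
    have xw: "2 * \<beta> * x < 1" "2 * \<beta> * x' < 1"
      using twist_mult_less_one[OF assms(3)] xb by auto
    have hH: "0 \<le> h" "h \<le> H" "0 \<le> h'" "h' \<le> H"
      using H(2) xb twist_scale_pos[OF assms(1)] xw by (auto simp: h_def h'_def intro: less_imp_le)
    have hk: "h\<^sup>2 * (1 - 2 * \<beta> * x) = k"
      using twist_scale_sq[OF assms(1) xw(1)] xw by (simp add: h_def)
    have hM: "\<bar>h' - h\<bar> \<le> M * r"
    proof -
      have "x' - x = (cmod z' - cmod z) * (cmod z' + cmod z)"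
        by (simp add: x_def x'_def power2_eq_square algebra_simps)
      moreover have "\<bar>cmod z' - cmod z\<bar> \<le> r"
        using norm_triangle_ineq3[of z' z] r(3) by (simp add: w_def)
      ultimately have "\<bar>x' - x\<bar> \<le> r * (2 * B)"
        using zB r by (auto simp: abs_mult intro!: mult_mono)
      then have "L * \<bar>x' - x\<bar> \<le> L * (r * (2 * B))"
        using L(1) by (rule mult_left_mono)
      then show ?thesis
        using L(2)[OF xb(2,1)] by (simp add: M_def h_def h'_def mult_ac)
    qed
    \<comment> \<open>Since \<open>x\<close> is real, \<open>Im u = Im (z * cnj w)\<close> is of
      order \<open>r\<close>.\<close>
    have u: "u = of_real x + z * cnj w"
      by (simp add: u_def w_def x_def complex_norm_square algebra_simps del: of_real_power)
    have zw: "cmod (z * cnj w) \<le> B * r"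
      using zB r nn by (auto simp: norm_mult intro!: mult_mono)
    have Imu: "\<bar>Im u\<bar> \<le> B * r"
      using abs_Im_le_cmod[of "z * cnj w"] zw by (simp add: u)
    have uB: "cmod u \<le> B\<^sup>2"
      using zB nn by (auto simp: u_def norm_mult power2_eq_square intro!: mult_mono)
    \<comment> \<open>Unlike \<open>\<tau>\<close>, the plain height difference
      \<open>\<delta> = \<tau> + 2 * Im u\<close> is only of first order.\<close>
    have "\<bar>\<delta>\<bar> \<le> r\<^sup>2 + 2 * (B * r)"
      using r(4) Imu by (simp add: \<tau>_def)
    also have "r\<^sup>2 \<le> r"
      using r by (simp add: power2_eq_square mult_left_le)
    finally have "\<bar>\<delta>\<bar> \<le> (1 + 2 * B) * r"
      by (simp add: algebra_simps)
    then have "\<bar>\<beta>\<bar> * \<bar>\<delta>\<bar> \<le> \<bar>\<beta>\<bar> * ((1 + 2 * B) * r)"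
      by (intro mult_left_mono) auto
    then have bd: "\<bar>\<beta> * \<delta>\<bar> \<le> E * r"
      by (simp add: E_def abs_mult mult_ac)
    have e: "cmod e = 1" "e * cnj e = 1"
      by (simp_all add: e_def exp_cnj flip: exp_add)
    have \<epsilon>: "cmod \<epsilon> = 1" "cmod (\<epsilon> - 1) \<le> E * r"
      using cmod_iexp_minus_one_le[of "\<beta> * \<delta>"] bd by (auto simp: \<epsilon>_def)
    have c\<epsilon>: "cnj \<epsilon> = exp (\<i> * of_real (- (\<beta> * \<delta>)))"
      by (simp add: \<epsilon>_def exp_cnj)
    have c\<epsilon>1: "cmod (cnj \<epsilon> - 1) \<le> E * r"
      using cmod_iexp_minus_one_le[of "- (\<beta> * \<delta>)"] bd unfolding c\<epsilon> by linarith
    have "cmod (cnj \<epsilon> - 1 + \<i> * of_real (\<beta> * \<delta>)) \<le> (\<beta> * \<delta>)\<^sup>2"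
      using cmod_iexp_minus_linear_le[of "- (\<beta> * \<delta>)"] unfolding c\<epsilon> by simp
    also have "\<dots> \<le> (E * r)\<^sup>2"
      using bd by (simp add: abs_le_square_iff[symmetric])
    finally have c\<epsilon>2: "cmod (cnj \<epsilon> - 1 + \<i> * of_real (\<beta> * \<delta>)) \<le> E\<^sup>2 * r\<^sup>2"
      by (simp add: power_mult_distrib)
    have Fp: "fst (heis_twist k \<beta> \<alpha> p) = z * h * e"
      by (simp add: heis_twist_def z_def h_def x_def e_def)
    have Fq: "fst (heis_twist k \<beta> \<alpha> q) = z' * h' * (e * \<epsilon>)"
      by (simp add: heis_twist_def z'_def h'_def x'_def e_def \<epsilon>_def \<delta>_def algebra_simps flip: exp_add)
    \<comment> \<open>Telescoping: the factors \<open>z\<close>, \<open>h\<close> and the rotation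
      change one at a time.\<close>
    have "z' * h' * (e * \<epsilon>) - z * h * e
        = e * (w * h' * \<epsilon> + z * of_real (h' - h) * \<epsilon> + z * h * (\<epsilon> - 1))"
      by (simp add: w_def algebra_simps)
    then have "cmod (z' * h' * (e * \<epsilon>) - z * h * e)
        = cmod (w * h' * \<epsilon> + z * of_real (h' - h) * \<epsilon> + z * h * (\<epsilon> - 1))"
      by (simp only: norm_mult e mult_1)
    also have "\<dots> \<le> cmod (w * h' * \<epsilon>) + cmod (z * of_real (h' - h) * \<epsilon>) + cmod (z * h * (\<epsilon> - 1))"
      by (intro order_trans[OF norm_triangle_ineq] add_right_mono norm_triangle_ineq)
    also have "\<dots> = cmod w * h' + cmod z * \<bar>h' - h\<bar> + cmod z * h * cmod (\<epsilon> - 1)"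
      using hH by (simp only: norm_mult \<epsilon> norm_of_real abs_of_nonneg mult_1_right)
    also have "\<dots> \<le> r * H + B * (M * r) + B * H * (E * r)"
      using r zB hH nn hM \<epsilon>(2) by (intro add_mono mult_mono) auto
    also have "\<dots> = c1 * r"
      by (simp add: c1_def algebra_simps)
    also have "\<dots> \<le> (1 + c1 + c2) * r"
      using nn r by (intro mult_right_mono) auto
    finally have W: "cmod (z' * h' * (e * \<epsilon>) - z * h * e) \<le> (1 + c1 + c2) * r" .
    \<comment> \<open>\<open>A\<close> is the second-order part of the rotation: a Taylor remainder
      of \<open>cnj \<epsilon>\<close> times \<open>u\<close>, plus a product of two first-order
      quantities. The identity after it is the form in which it occurs in the height
      difference.\<close>
    define A where "A = - (u * (cnj \<epsilon> - 1 + \<i> * of_real (\<beta> * \<delta>))) + \<i> * of_real (\<beta> * \<delta>) * (z * cnj w)"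
    have A: "A = u - u * cnj \<epsilon> - \<i> * of_real (\<beta> * \<delta> * x)"
      by (simp add: A_def u algebra_simps)
    have "cmod A \<le> cmod u * cmod (cnj \<epsilon> - 1 + \<i> * of_real (\<beta> * \<delta>)) + \<bar>\<beta> * \<delta>\<bar> * cmod (z * cnj w)"
      unfolding A_def by (rule order_trans[OF norm_triangle_ineq]) (simp add: norm_mult abs_mult)
    also have "\<dots> \<le> B\<^sup>2 * (E\<^sup>2 * r\<^sup>2) + (E * r) * (B * r)"
      using uB c\<epsilon>2 bd zw nn r by (intro add_mono mult_mono) auto
    also have "\<dots> = (B\<^sup>2 * E\<^sup>2 + E * B) * r\<^sup>2"
      by (simp add: algebra_simps power2_eq_square)
    finally have "\<bar>Im A\<bar> \<le> (B\<^sup>2 * E\<^sup>2 + E * B) * r\<^sup>2"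
      using abs_Im_le_cmod[of A] by linarith
    then have t2: "\<bar>2 * h\<^sup>2 * Im A\<bar> \<le> 2 * H\<^sup>2 * ((B\<^sup>2 * E\<^sup>2 + E * B) * r\<^sup>2)"
      using hH nn r unfolding abs_mult by (intro mult_mono) (auto intro!: power_mono)
    have t1: "\<bar>h\<^sup>2 * \<tau>\<bar> \<le> H\<^sup>2 * r\<^sup>2"
      using hH r unfolding abs_mult by (intro mult_mono) (auto intro!: power_mono)
    have "\<bar>Im (u * (cnj \<epsilon> - 1))\<bar> \<le> B\<^sup>2 * (E * r)"
      by (rule order_trans[OF abs_Im_le_cmod])
        (use uB c\<epsilon>1 nn r in \<open>simp only: norm_mult, intro mult_mono, auto\<close>)
    \<comment> \<open>In \<open>u * cnj \<epsilon> = u + u * (cnj \<epsilon> - 1)\<close> both parts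
      have imaginary part of order \<open>r\<close>; the change of scale then supplies a second
      factor \<open>r\<close>.\<close>
    then have "\<bar>Im (u * cnj \<epsilon>)\<bar> \<le> (B + B\<^sup>2 * E) * r"
      using Imu by (simp add: algebra_simps)
    then have "\<bar>(h * (h - h')) * Im (u * cnj \<epsilon>)\<bar> \<le> (H * (M * r)) * ((B + B\<^sup>2 * E) * r)"
      unfolding abs_mult using hH hM nn r by (intro mult_mono) auto
    then have t3: "\<bar>2 * (h * (h - h')) * Im (u * cnj \<epsilon>)\<bar> \<le> 2 * (H * M) * (B + B\<^sup>2 * E) * r\<^sup>2"
    proof -
      assume "\<bar>(h * (h - h')) * Im (u * cnj \<epsilon>)\<bar> \<le> (H * (M * r)) * ((B + B\<^sup>2 * E) * r)"
      moreover have "\<bar>2 * (h * (h - h')) * Im (u * cnj \<epsilon>)\<bar> = 2 * \<bar>(h * (h - h')) * Im (u * cnj \<epsilon>)\<bar>"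
        by (simp only: mult.assoc abs_mult abs_numeral)
      moreover have "2 * (H * M) * (B + B\<^sup>2 * E) * r\<^sup>2 = 2 * ((H * (M * r)) * ((B + B\<^sup>2 * E) * r))"
        by (simp only: power2_eq_square mult_ac)
      ultimately show ?thesis by linarith
    qed
    have "z * h * e * cnj (z' * h' * (e * \<epsilon>)) = (e * cnj e) * (of_real (h * h') * (u * cnj \<epsilon>))"
      by (simp add: u_def mult_ac)
    then have "Im (z * h * e * cnj (z' * h' * (e * \<epsilon>))) = h * h' * Im (u * cnj \<epsilon>)"
      unfolding e mult_1_left by (simp only: Im_of_real_mult)
    \<comment> \<open>Here \<open>k\<close> is replaced by
      \<open>h\<^sup>2 * (1 - 2 * \<beta> * x)\<close>; this is what lets the difference be
      regrouped into the three second-order terms.\<close>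
    then have "k * snd q - k * snd p - 2 * Im (z * h * e * cnj (z' * h' * (e * \<epsilon>)))
        = h\<^sup>2 * (1 - 2 * \<beta> * x) * \<delta> - 2 * (h * h' * Im (u * cnj \<epsilon>))"
      by (simp only: hk) (simp add: \<delta>_def right_diff_distrib)
    also have "\<dots> = h\<^sup>2 * \<tau> + 2 * h\<^sup>2 * Im A + 2 * (h * (h - h')) * Im (u * cnj \<epsilon>)"
      unfolding A \<tau>_def minus_complex.sel times_complex.sel
      by (simp add: algebra_simps power2_eq_square)
    finally have "\<bar>k * snd q - k * snd p - 2 * Im (z * h * e * cnj (z' * h' * (e * \<epsilon>)))\<bar>
        \<le> H\<^sup>2 * r\<^sup>2 + 2 * H\<^sup>2 * ((B\<^sup>2 * E\<^sup>2 + E * B) * r\<^sup>2) + 2 * (H * M) * (B + B\<^sup>2 * E) * r\<^sup>2"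
      using t1 t2 t3 by linarith
    also have "\<dots> = c2 * r\<^sup>2"
      by (simp add: c2_def algebra_simps)
    also have "\<dots> \<le> (1 + c1 + c2) * r\<^sup>2"
      using nn by (intro mult_right_mono) auto
    finally have T: "\<bar>k * snd q - k * snd p - 2 * Im (z * h * e * cnj (z' * h' * (e * \<epsilon>)))\<bar>
        \<le> (1 + c1 + c2) * r\<^sup>2" .
    show ?thesis
      unfolding r_def[symmetric]
    proof (rule heis_dist_le)
      show "cmod (fst (heis_twist k \<beta> \<alpha> q) - fst (heis_twist k \<beta> \<alpha> p)) \<le> (1 + c1 + c2) * r"
        unfolding Fp Fq by (rule W)
      have s: "snd (heis_twist k \<beta> \<alpha> p) = k * snd p" for p
        by (simp add: heis_twist_def)
      show "\<bar>snd (heis_twist k \<beta> \<alpha> q) - snd (heis_twist k \<beta> \<alpha> p)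
          - 2 * Im (fst (heis_twist k \<beta> \<alpha> p) * cnj (fst (heis_twist k \<beta> \<alpha> q)))\<bar> \<le> (1 + c1 + c2) * r\<^sup>2"
        unfolding Fp Fq s by (rule T)
    qed (use nn r in auto)
  qed
  then show ?thesis
    using that[of "2 * (1 + c1 + c2)"] nn by simp
qed

text \<open>On a small sphere of radius \<open>r\<close> the images lie at distances between
  \<open>r / C'\<close> and \<open>C * r\<close>, with \<open>C\<close> from the twist and
  \<open>C'\<close> from its inverse, so \<open>C * C'\<close> serves for all centres at
  once.\<close>

lemma distortion_heis_twist:
  assumes k: "k > 0" "b > 0" "2 * \<beta> * b < 1"
  obtains K where "\<And>f p. \<forall>q\<in>cyl a b. f q = heis_twist k \<beta> \<alpha> q \<Longrightarrow> p \<in> cyl a b \<Longrightarrow>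
    distortion (cyl a b) f p \<le> ereal K"
proof -
  define b' where "b' = k * b / (1 - 2 * \<beta> * b)"
  have w: "1 - 2 * \<beta> * b > 0" using assms by simp
  have b': "b' > 0" using assms by (simp add: b'_def)
  have "1 - 2 * (- \<beta> / k) * b' = 1 / (1 - 2 * \<beta> * b)"
    using assms(1) w by (simp add: b'_def field_simps)
  moreover have "1 / (1 - 2 * \<beta> * b) > 0" using w by simp
  ultimately have less: "2 * (- \<beta> / k) * b' < 1" by linarith
  obtain C where C: "C > 0" "\<And>p q. (cmod (fst p))\<^sup>2 \<le> b \<Longrightarrow> (cmod (fst q))\<^sup>2 \<le> b \<Longrightarrow> heis_dist p q \<le> 1 \<Longrightarrow>
      heis_dist (heis_twist k \<beta> \<alpha> p) (heis_twist k \<beta> \<alpha> q) \<le> C * heis_dist p q"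
    using heis_twist_lipschitz[OF k] by metis
  obtain C' where C': "C' > 0" "\<And>p q. (cmod (fst p))\<^sup>2 \<le> b' \<Longrightarrow> (cmod (fst q))\<^sup>2 \<le> b' \<Longrightarrow> heis_dist p q \<le> 1 \<Longrightarrow>
      heis_dist (heis_twist (1 / k) (- \<beta> / k) (- \<alpha>) p) (heis_twist (1 / k) (- \<beta> / k) (- \<alpha>) q)
        \<le> C' * heis_dist p q"
    using heis_twist_lipschitz[OF _ b' less, of "1 / k"] k(1) by (metis zero_less_divide_1_iff)
  have "distortion (cyl a b) f p \<le> ereal (C * C')"
    if f: "\<forall>q\<in>cyl a b. f q = heis_twist k \<beta> \<alpha> q" and p: "p \<in> cyl a b" for f p
    unfolding distortion_def
  proof (rule Limsup_bounded)
    \<comment> \<open>Radii below \<open>1 / C\<close> keep the images at distance at most 1, where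
      the Lipschitz bound of the inverse twist is available.\<close>
    have "\<forall>\<^sub>F r in at_right 0. 0 < r \<and> r < min 1 (1 / C)"
      using C(1) by (intro eventually_conj eventually_at_right_less eventually_at_right_field[THEN iffD2] exI[of _ "min 1 (1 / C)"]) auto
    then show "\<forall>\<^sub>F r in at_right 0.
        (SUP q\<in>{q \<in> cyl a b. heis_dist p q = r}. ereal (heis_dist (f p) (f q))) /
        (INF q\<in>{q \<in> cyl a b. heis_dist p q = r}. ereal (heis_dist (f p) (f q))) \<le> ereal (C * C')"
    proof eventually_elim
      case (elim r)
      let ?S = "{q \<in> cyl a b. heis_dist p q = r}"
      define s i where "s = (SUP q\<in>?S. ereal (heis_dist (f p) (f q)))"
        and "i = (INF q\<in>?S. ereal (heis_dist (f p) (f q)))"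
      have cyl: "(cmod (fst q))\<^sup>2 \<le> b" "(cmod (fst (f q)))\<^sup>2 \<le> b'"
        "heis_twist (1 / k) (- \<beta> / k) (- \<alpha>) (f q) = q" if "q \<in> cyl a b" for q
        using that f heis_twist_in_cyl[OF k that, of \<alpha>] cyl_iff[OF k(2)] cyl_iff[OF b']
          homeomorphism_apply1[OF homeomorphism_heis_twist[OF k] that]
        by (auto simp: b'_def)
      have up: "heis_dist (f p) (f q) \<le> C * r" if "q \<in> ?S" for q
        using C(2)[OF cyl(1)[OF p] cyl(1)[of q]] that f p elim by auto
      have Cr: "C * r \<le> 1"
        using elim C(1) by (simp add: field_simps)
      have lo: "r / C' \<le> heis_dist (f p) (f q)" if "q \<in> ?S" for q
      proof -
        have "heis_dist (f p) (f q) \<le> 1"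
          using up[OF that] Cr by linarith
        then show ?thesis
          using C'(2)[OF cyl(2)[OF p] cyl(2)[of q]] cyl(3)[OF p] cyl(3)[of q] that C'(1)
          by (simp add: field_simps)
      qed
      \<comment> \<open>Both bounds also hold for an empty sphere, where \<open>s\<close> is minus
        infinity and \<open>i\<close> is infinity.\<close>
      have s: "s \<le> ereal (C * r)"
        unfolding s_def using up by (intro SUP_least) auto
      have i: "ereal (r / C') \<le> i"
        unfolding i_def using lo by (intro INF_greatest) auto
      have r: "0 < ereal (r / C')"
        using elim C'(1) by simp
      have "0 \<le> inverse i"
        using order_trans[OF less_imp_le[OF r] i] by (simp add: ereal_inverse_nonneg_iff)
      then have "s / i \<le> ereal (C * r) * inverse i"
        unfolding divide_ereal_def using s by (rule ereal_mult_right_mono[rotated])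
      also have "\<dots> \<le> ereal (C * r) * inverse (ereal (r / C'))"
        using r i elim C(1) by (intro ereal_mult_left_mono ereal_inverse_antimono) auto
      also have "\<dots> = ereal (C * C')"
        using elim C'(1) by simp
      finally show ?case
        by (simp add: s_def i_def)
    qed
  qed
  then show ?thesis
    using that by blast
qed

section \<open>Orientation and quasiconformality of twists\<close>

lemma orientation_preserving_on_heis_twist:
  assumes "k > 0" "b > 0" "0 \<le> \<beta>" "2 * \<beta> * b < 1"
    and f: "\<forall>p\<in>cyl a b. f p = heis_twist k \<beta> \<alpha> p"
  shows "orientation_preserving_on (cyl a b) f"
proof -
  define U where "U = cyl a b"
  define y0 where "y0 = \<beta> * b"
  define u0 where "u0 = 2 * y0 * (1 - y0)"
  have w: "2 * \<beta> * (cmod (fst p))\<^sup>2 < 1" if "p \<in> U" for p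
    using twist_mult_less_one[OF assms(4)] that cyl_iff[OF assms(2)] by (auto simp: U_def)
  \<comment> \<open>Completing the square: \<open>u0\<close> stays below \<open>1/2\<close> because
    \<open>y0 < 1/2\<close>, and this makes the bound \<open>u0 / (1 - u0)\<close> of the dilatation
    less than 1.\<close>
  have "u0 = 1 / 2 - 2 * (1 / 2 - y0)\<^sup>2"
    by (simp add: u0_def power2_eq_square algebra_simps)
  moreover have "(1 / 2 - y0)\<^sup>2 > 0"
    using assms(4) by (simp add: y0_def)
  ultimately have u0: "u0 < 1 / 2" by linarith
  have dil: "cmod (twist_dilatation \<beta> (fst p)) \<le> u0 / (1 - u0)" if "p \<in> U" for p
  proof -
    define y where "y = \<beta> * (cmod (fst p))\<^sup>2"
    define u where "u = 2 * y * (1 - y)"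
    have y: "0 \<le> y" "y \<le> y0" "y0 < 1 / 2"
      using that cyl_iff[OF assms(2)] assms(3,4) by (auto simp: U_def y_def y0_def intro!: mult_left_mono)
    \<comment> \<open>This factorization shows that \<open>2 * y * (1 - y)\<close> increases up to
      \<open>y0\<close>, so the boundary value \<open>y0\<close> gives a bound for the whole
      cylinder.\<close>
    have "u0 - u = 2 * (y0 - y) * (1 - y0 - y)"
      by (simp add: u_def u0_def algebra_simps)
    moreover have "0 \<le> 2 * (y0 - y) * (1 - y0 - y)" "0 \<le> u"
      using y by (auto simp: u_def)
    ultimately have u: "0 \<le> u" "u \<le> u0"
      by linarith+
    have "cmod (twist_dilatation \<beta> (fst p)) = \<bar>2 * \<beta> * (1 - y) / (1 - u)\<bar> * (cmod (fst p))\<^sup>2"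
      by (simp add: twist_dilatation_def Let_def norm_mult norm_power norm_of_real flip: y_def u_def
          del: of_real_mult of_real_divide of_real_diff)
    also have "\<dots> = u / (1 - u)"
      using y u u0 assms(3) by (simp add: u_def y_def abs_of_nonneg)
    also have "\<dots> \<le> u0 / (1 - u0)"
      using u u0 by (intro frac_le) auto
    finally show ?thesis .
  qed
  have "1 - 2 * (\<beta> * (cmod z)\<^sup>2) * (1 - \<beta> * (cmod z)\<^sup>2) \<noteq> 0" for z
    using two_mult_one_minus_le_half[of "\<beta> * (cmod z)\<^sup>2"] by linarith
  then have "continuous_on UNIV (twist_dilatation \<beta>)"
    unfolding twist_dilatation_def[abs_def] Let_def by (intro continuous_intros) auto
  then have "continuous_on UNIV (\<lambda>p::heis. twist_dilatation \<beta> (fst p))"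
    by (rule continuous_on_compose2) (auto intro: continuous_intros)
  then have m: "(\<lambda>p::heis. twist_dilatation \<beta> (fst p)) \<in> borel_measurable (lebesgue_on U)"
    by (intro measurable_restrict_space1 measurable_completion) (simp add: borel_measurable_continuous_onI)
  \<comment> \<open>\<open>f\<close> is known to be a twist on the cylinder only; since the cylinder
    is open, the differentials there are those of the twist.\<close>
  have D1: "((\<lambda>p. fst (f p)) has_derivative heis_twist_D1 k \<beta> \<alpha> p) (at p)" if "p \<in> U" for p
    by (rule has_derivative_transform_within_open[OF has_derivative_heis_twist_fst[OF assms(1) w[OF that]]
          open_cyl[of a b]]) (use that f in \<open>auto simp: U_def\<close>)
  have D2: "((\<lambda>p. of_real (snd (f p)) + \<i> * of_real ((cmod (fst (f p)))\<^sup>2)) has_derivative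
      (\<lambda>v. of_real (k * snd v) + \<i> * of_real (k / (1 - 2 * \<beta> * (cmod (fst p))\<^sup>2)\<^sup>2 * (2 * Re (cnj (fst p) * fst v))))) (at p)"
    if "p \<in> U" for p
  proof -
    have "((\<lambda>x. k * x / (1 - 2 * \<beta> * x)) has_real_derivative k / (1 - 2 * \<beta> * (cmod (fst p))\<^sup>2)\<^sup>2) (at ((cmod (fst p))\<^sup>2))"
      using w[OF that] by (auto intro!: derivative_eq_intros simp: power2_eq_square algebra_simps)
    from has_derivative_compose[OF has_derivative_cmod_fst_sq this[unfolded has_field_derivative_def]]
    have "((\<lambda>p::heis. k * (cmod (fst p))\<^sup>2 / (1 - 2 * \<beta> * (cmod (fst p))\<^sup>2)) has_derivative
        (\<lambda>v. k / (1 - 2 * \<beta> * (cmod (fst p))\<^sup>2)\<^sup>2 * (2 * Re (cnj (fst p) * fst v)))) (at p)" .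
    then have "((\<lambda>p::heis. of_real (k * snd p) + \<i> * of_real (k * (cmod (fst p))\<^sup>2 / (1 - 2 * \<beta> * (cmod (fst p))\<^sup>2)))
       has_derivative (\<lambda>v. of_real (k * snd v) + \<i> * of_real (k / (1 - 2 * \<beta> * (cmod (fst p))\<^sup>2)\<^sup>2 *
          (2 * Re (cnj (fst p) * fst v))))) (at p)"
      by (intro has_derivative_add has_derivative_mult_right has_derivative_of_real has_derivative_snd
          has_derivative_ident)
    then show ?thesis
    proof (rule has_derivative_transform_within_open[OF _ open_cyl[of a b]])
      show "p \<in> cyl a b" using that by (simp add: U_def)
      fix q assume q: "q \<in> cyl a b"
      then show "of_real (k * snd q) + \<i> * of_real (k * (cmod (fst q))\<^sup>2 / (1 - 2 * \<beta> * (cmod (fst q))\<^sup>2))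
          = of_real (snd (f q)) + \<i> * of_real ((cmod (fst (f q)))\<^sup>2)"
        using f cmod_heis_twist_fst_sq[OF assms(1) w, of q \<alpha>] by (simp add: U_def del: of_real_power) (simp add: heis_twist_def)
    qed
  qed
  have "heis_Zbar (\<lambda>p. fst (f p)) p = twist_dilatation \<beta> (fst p) * heis_Z (\<lambda>p. fst (f p)) p"
    "heis_Zbar (\<lambda>p. of_real (snd (f p)) + \<i> * of_real ((cmod (fst (f p)))\<^sup>2)) p
      = twist_dilatation \<beta> (fst p) * heis_Z (\<lambda>p. of_real (snd (f p)) + \<i> * of_real ((cmod (fst (f p)))\<^sup>2)) p"
    if "p \<in> U" for p
    using heis_twist_beltrami_fst[OF w D1] heis_twist_beltrami_snd[OF w D2] that by blast+
  moreover have "esssup (lebesgue_on U) (\<lambda>p. ereal (cmod (twist_dilatation \<beta> (fst p)))) < 1"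
  proof -
    have "esssup (lebesgue_on U) (\<lambda>p. ereal (cmod (twist_dilatation \<beta> (fst p)))) \<le> ereal (u0 / (1 - u0))"
      by (intro esssup_I AE_I2 borel_measurable_ereal measurable_compose[OF m] borel_measurable_norm)
        (use dil in auto)
    also have "\<dots> < 1"
      using u0 by simp
    finally show ?thesis .
  qed
  ultimately show ?thesis
    unfolding orientation_preserving_on_def Let_def U_def[symmetric]
    using m by (intro exI[of _ "\<lambda>p. twist_dilatation \<beta> (fst p)"] conjI AE_I2) auto
qed

lemma C2_on_transform:
  assumes "C2_on U g" "open U" "\<And>x. x \<in> U \<Longrightarrow> f x = g x"
  shows "C2_on U f"
proof -
  obtain g' where g': "\<forall>x\<in>U. (g has_derivative blinfun_apply (g' x)) (at x)" "C1_on U g'"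
    using assms(1) unfolding C2_on_iff_C1_on by blast
  have "(f has_derivative blinfun_apply (g' x)) (at x)" if "x \<in> U" for x
    by (rule has_derivative_transform_within_open[OF bspec[OF g'(1) that] assms(2) that]) (simp add: assms(3))
  then show ?thesis
    unfolding C2_on_iff_C1_on using g'(2) by blast
qed

lemma heis_quasiconformal_heis_twist:
  assumes "k > 0" "a > 0" "b > 0" "0 \<le> \<beta>" "2 * \<beta> * b < 1"
    and f: "\<forall>p\<in>cyl a b. f p = heis_twist k \<beta> \<alpha> p"
  shows "heis_quasiconformal (cyl a b) (cyl (k * a) (k * b / (1 - 2 * \<beta> * b))) f"
proof -
  have w: "2 * \<beta> * (cmod (fst p))\<^sup>2 < 1" if "p \<in> cyl a b" for p
    using twist_mult_less_one[OF assms(5)] that cyl_iff[OF assms(3)] by auto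
  have "contact_on (cyl a b) f"
    unfolding contact_on_def
  proof (intro exI ballI conjI allI)
    fix p v assume p: "p \<in> cyl a b"
    show "(twist_scale k \<beta> ((cmod (fst p))\<^sup>2))\<^sup>2 \<noteq> 0"
      using twist_scale_pos[OF assms(1) w[OF p]] by simp
    have "((\<lambda>p. (fst (heis_twist k \<beta> \<alpha> p), k * snd p)) has_derivative
        (\<lambda>v. (heis_twist_D1 k \<beta> \<alpha> p v, k * snd v))) (at p)"
      by (intro has_derivative_Pair has_derivative_heis_twist_fst[OF assms(1) w[OF p]]
          has_derivative_mult_right has_derivative_snd has_derivative_ident)
    then have "(f has_derivative (\<lambda>v. (heis_twist_D1 k \<beta> \<alpha> p v, k * snd v))) (at p)"
      by (rule has_derivative_transform_within_open[OF _ open_cyl p]) (simp add: f heis_twist_def)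
    then show "heis_form (f p) (frechet_derivative f (at p) v)
        = of_real ((twist_scale k \<beta> ((cmod (fst p))\<^sup>2))\<^sup>2) * heis_form p v"
      using heis_twist_contact[OF assms(1) w[OF p]] f p by (simp flip: frechet_derivative_at)
  qed
  moreover have "C2_on (cyl a b) f"
    using C2_on_heis_twist[OF assms(1) w] open_cyl by (rule C2_on_transform) (use f in auto)
  moreover have "orientation_preserving_on (cyl a b) f"
    by (rule orientation_preserving_on_heis_twist[OF assms(1,3,4,5,6)])
  moreover have "\<exists>g. homeomorphism (cyl a b) (cyl (k * a) (k * b / (1 - 2 * \<beta> * b))) f g"
    using homeomorphism_cong[OF homeomorphism_heis_twist[OF assms(1,3,5)]] f by metis
  moreover have "\<exists>K::real. \<forall>p\<in>cyl a b. distortion (cyl a b) f p \<le> ereal K"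
    using distortion_heis_twist[OF assms(1,3,5)] f by metis
  ultimately show ?thesis
    using assms by (auto simp: heis_quasiconformal_def intro!: heis_domain_cyl)
qed

section \<open>Contact lifts of maps of the half-plane\<close>

text \<open>The axis is left out because the argument of \<open>z\<close> is used as a coordinate;
  the values on it are recovered later by continuity.\<close>

locale contact_lift =
  fixes f :: "heis \<Rightarrow> heis" and Df :: "heis \<Rightarrow> heis \<Rightarrow> heis" and lam :: "heis \<Rightarrow> real"
    and \<phi> :: "real \<Rightarrow> real" and a b k :: real
  assumes a_pos: "a > 0" and b_pos: "b > 0"
    and phi_pos: "\<And>x. 0 < x \<Longrightarrow> x < b \<Longrightarrow> \<phi> x > 0"
    and deriv: "\<And>p. p \<in> cyl a b \<Longrightarrow> fst p \<noteq> 0 \<Longrightarrow> (f has_derivative Df p) (at p)"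
    and contact: "\<And>p v. p \<in> cyl a b \<Longrightarrow> fst p \<noteq> 0 \<Longrightarrow>
      snd (Df p v) + 2 * Im (cnj (fst (f p)) * fst (Df p v)) = lam p * (snd v + 2 * Im (cnj (fst p) * fst v))"
    and snd_f: "\<And>p. p \<in> cyl a b \<Longrightarrow> fst p \<noteq> 0 \<Longrightarrow> snd (f p) = k * snd p"
    and fst_f: "\<And>p. p \<in> cyl a b \<Longrightarrow> fst p \<noteq> 0 \<Longrightarrow> (cmod (fst (f p)))\<^sup>2 = \<phi> ((cmod (fst p))\<^sup>2)"
begin

text \<open>In the coordinate \<open>w = ln z\<close> the punctured cylinder becomes the convex set \<open>strip\<close>. There
  \<open>phase\<close> is \<open>exp (i \<psi>)\<close> and \<open>phase_form\<close> is \<open>d\<psi>\<close>.\<close>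

definition strip :: "heis set" where
  "strip = {w. Re w < ln b / 2} \<times> {0<..<a}"

definition log_chart :: "heis \<Rightarrow> heis" where
  "log_chart q = (exp (fst q), snd q)"

definition log_lift :: "heis \<Rightarrow> complex" where
  "log_lift q = fst (f (log_chart q))"

definition phase :: "heis \<Rightarrow> complex" where
  "phase q = log_lift q * of_real (inverse (cmod (log_lift q)))"

definition phase_deriv :: "heis \<Rightarrow> heis \<Rightarrow> complex" where
  "phase_deriv q = frechet_derivative phase (at q)"

definition phase_form :: "heis \<Rightarrow> heis \<Rightarrow> real" where
  "phase_form q v = Im (cnj (phase q) * phase_deriv q v)"

lemma open_strip: "open strip"
  unfolding strip_def by (intro open_Times open_halfspace_Re_lt) auto

lemma convex_strip: "convex strip"
  unfolding strip_def by (intro convex_Times convex_halfspace_Re_lt) auto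

lemma cmod_log_chart: "(cmod (fst (log_chart q)))\<^sup>2 = exp (2 * Re (fst q))"
  by (simp add: log_chart_def exp_double)

lemma cmod_log_chart_less: "q \<in> strip \<Longrightarrow> (cmod (fst (log_chart q)))\<^sup>2 < b"
  unfolding cmod_log_chart strip_def using b_pos exp_less_cancel_iff[of "2 * Re (fst q)" "ln b"] by auto

lemma log_chart_in_cyl:
  assumes "q \<in> strip"
  shows "log_chart q \<in> cyl a b" and "fst (log_chart q) \<noteq> 0"
  using assms cmod_log_chart_less[of q] real_sqrt_less_iff[of "(cmod (fst (log_chart q)))\<^sup>2" b]
  by (auto simp: cyl_def log_chart_def strip_def)

lemma cmod_log_lift:
  assumes q: "q \<in> strip"
  shows "(cmod (log_lift q))\<^sup>2 = \<phi> (exp (2 * Re (fst q)))"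
  unfolding log_lift_def using fst_f[OF log_chart_in_cyl[OF q]] by (simp add: cmod_log_chart)

lemma log_lift_nonzero: "q \<in> strip \<Longrightarrow> log_lift q \<noteq> 0"
  using cmod_log_lift[of q] phi_pos[of "exp (2 * Re (fst q))"] cmod_log_chart_less[of q]
  by (auto simp: cmod_log_chart)

lemma has_derivative_log_lift:
  assumes "q \<in> strip"
  shows "(log_lift has_derivative (\<lambda>v. fst (Df (log_chart q) (exp (fst q) * fst v, snd v)))) (at q)"
proof -
  have "(log_chart has_derivative (\<lambda>v. (exp (fst q) * fst v, snd v))) (at q)"
    unfolding log_chart_def[abs_def]
    by (intro has_derivative_Pair has_derivative_snd has_derivative_ident
        has_derivative_compose[OF has_derivative_fst[OF has_derivative_ident] DERIV_exp[unfolded has_field_derivative_def]])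
  from has_derivative_fst[OF has_derivative_compose[OF this deriv[OF log_chart_in_cyl[OF assms]]]]
  show ?thesis
    unfolding log_lift_def[abs_def] .
qed

lemma cmod_phase: "q \<in> strip \<Longrightarrow> cmod (phase q) = 1"
  using log_lift_nonzero[of q] by (simp add: phase_def norm_mult norm_inverse)

lemma cnj_phase_mult: "q \<in> strip \<Longrightarrow> cnj (phase q) * phase q = 1"
  using cmod_phase[of q] complex_norm_square[of "phase q"] by (simp add: mult.commute)

lemma log_lift_eq: "q \<in> strip \<Longrightarrow> log_lift q = of_real (cmod (log_lift q)) * phase q"
  using log_lift_nonzero[of q] by (simp add: phase_def)

lemma cmod_log_lift_differentiable: "q \<in> strip \<Longrightarrow> (\<lambda>q. cmod (log_lift q)) differentiable (at q)"
  by (rule differentiableI[OF has_derivative_compose[OF has_derivative_log_lift has_derivative_norm[OF log_lift_nonzero]]])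

lemma has_derivative_phase:
  assumes q: "q \<in> strip"
  shows "(phase has_derivative phase_deriv q) (at q)"
proof -
  have "(\<lambda>q. inverse (cmod (log_lift q))) differentiable (at q)"
    using differentiable_inverse[OF cmod_log_lift_differentiable[OF q]] log_lift_nonzero[OF q] by simp
  then obtain D where "((\<lambda>q. inverse (cmod (log_lift q))) has_derivative D) (at q)"
    by (auto simp: differentiable_def)
  then have "(\<lambda>q. complex_of_real (inverse (cmod (log_lift q)))) differentiable (at q)"
    by (rule differentiableI[OF has_derivative_of_real])
  then have "phase differentiable (at q)"
    unfolding phase_def[abs_def] by (intro differentiable_mult differentiableI[OF has_derivative_log_lift[OF q]])
  then show ?thesis
    unfolding phase_deriv_def by (simp add: frechet_derivative_works)
qed

text \<open>Differentiating \<open>cnj phase * phase = 1\<close> shows that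
  \<open>cnj phase * d phase\<close> is purely imaginary.\<close>

lemma phase_deriv_eq:
  assumes q: "q \<in> strip"
  shows "phase_deriv q v = \<i> * of_real (phase_form q v) * phase q"
proof -
  have "((\<lambda>q. cnj (phase q) * phase q) has_derivative (\<lambda>v. cnj (phase q) * phase_deriv q v + cnj (phase_deriv q v) * phase q)) (at q)"
    by (intro has_derivative_mult has_derivative_cnj has_derivative_phase q)
  moreover have "((\<lambda>q. cnj (phase q) * phase q) has_derivative (\<lambda>v. 0)) (at q)"
    by (rule has_derivative_transform_within_open[OF has_derivative_const open_strip q, of 1])
      (simp add: cnj_phase_mult)
  ultimately have eq: "(\<lambda>v. cnj (phase q) * phase_deriv q v + cnj (phase_deriv q v) * phase q) = (\<lambda>v. 0)"
    by (rule has_derivative_unique)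
  define X where "X = cnj (phase q) * phase_deriv q v"
  have "X + cnj X = 0"
    using fun_cong[OF eq, of v] by (simp add: X_def mult.commute)
  then have "Re (cnj (phase q) * phase_deriv q v) = 0"
    unfolding X_def[symmetric] by (simp add: complex_eq_iff)
  then have "cnj (phase q) * phase_deriv q v = \<i> * of_real (phase_form q v)"
    by (simp add: phase_form_def complex_eq_iff)
  then have "(cnj (phase q) * phase q) * phase_deriv q v = \<i> * of_real (phase_form q v) * phase q"
    by (simp add: mult_ac)
  then show ?thesis
    by (simp add: cnj_phase_mult[OF q])
qed

text \<open>For \<open>F = \<rho> * phase\<close> with real \<open>\<rho>\<close>, the product
  \<open>cnj F * dF\<close> is \<open>\<i> * \<rho>\<^sup>2 d\<psi>\<close> plus a real term from
  \<open>d\<rho>\<close>, so its imaginary part sees only \<open>d\<psi>\<close>.\<close>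

lemma Im_log_lift_deriv:
  assumes q: "q \<in> strip"
  shows "Im (cnj (log_lift q) * fst (Df (log_chart q) (exp (fst q) * fst v, snd v))) = \<phi> (exp (2 * Re (fst q))) * phase_form q v"
proof -
  obtain D where D: "((\<lambda>q. cmod (log_lift q)) has_derivative D) (at q)"
    using cmod_log_lift_differentiable[OF q] by (auto simp: differentiable_def)
  have "((\<lambda>q. of_real (cmod (log_lift q)) * phase q) has_derivative
      (\<lambda>v. of_real (cmod (log_lift q)) * phase_deriv q v + of_real (D v) * phase q)) (at q)"
    by (intro has_derivative_mult has_derivative_of_real D has_derivative_phase q)
  then have "(log_lift has_derivative (\<lambda>v. of_real (cmod (log_lift q)) * phase_deriv q v + of_real (D v) * phase q)) (at q)"
    by (rule has_derivative_transform_within_open[OF _ open_strip q]) (simp flip: log_lift_eq)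
  from fun_cong[OF has_derivative_unique[OF has_derivative_log_lift[OF q] this], of v]
  have "fst (Df (log_chart q) (exp (fst q) * fst v, snd v)) = of_real (cmod (log_lift q)) * phase_deriv q v + of_real (D v) * phase q" .
  moreover have "cnj (log_lift q) = of_real (cmod (log_lift q)) * cnj (phase q)"
    using arg_cong[OF log_lift_eq[OF q], of cnj] by simp
  ultimately have "cnj (log_lift q) * fst (Df (log_chart q) (exp (fst q) * fst v, snd v))
      = of_real ((cmod (log_lift q))\<^sup>2) * (cnj (phase q) * phase_deriv q v) + of_real (cmod (log_lift q) * D v) * (cnj (phase q) * phase q)"
    by (simp add: algebra_simps power2_eq_square)
  also have "Im \<dots> = (cmod (log_lift q))\<^sup>2 * phase_form q v"
    unfolding cnj_phase_mult[OF q] by (simp add: phase_form_def del: of_real_power)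
  finally show ?thesis
    by (simp add: cmod_log_lift[OF q])
qed

lemma snd_Df:
  assumes q: "p \<in> cyl a b" "fst p \<noteq> 0"
  shows "snd (Df p v) = k * snd v"
proof -
  let ?S = "{p \<in> cyl a b. fst p \<noteq> 0}"
  have "?S = cyl a b \<inter> (- {0}) \<times> UNIV" by auto
  then have "open ?S" using open_Int[OF open_cyl open_Times[of "- {0::complex}" UNIV]] by auto
  have "((\<lambda>p. k * snd p) has_derivative (\<lambda>v. k * snd v)) (at p)"
    by (intro has_derivative_mult_right has_derivative_snd has_derivative_ident)
  then have "((\<lambda>p. snd (f p)) has_derivative (\<lambda>v. k * snd v)) (at p)"
    by (rule has_derivative_transform_within_open[OF _ \<open>open ?S\<close>]) (use q snd_f in auto)
  from fun_cong[OF has_derivative_unique[OF has_derivative_snd[OF deriv[OF q]] this], of v]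
  show ?thesis .
qed

text \<open>The contact condition in the coordinate \<open>w = ln z\<close>: here
  \<open>dz = z dw\<close>, so \<open>Im (cnj z dz)\<close> is \<open>x\<close> times the increment
  of the argument \<open>Im w\<close>.\<close>

lemma contact_strip:
  assumes q: "q \<in> strip"
  shows "k * snd v + 2 * \<phi> (exp (2 * Re (fst q))) * phase_form q v
    = lam (log_chart q) * (snd v + 2 * exp (2 * Re (fst q)) * Im (fst v))"
proof -
  have eq: "cnj (exp (fst q)) * (exp (fst q) * fst v) = of_real ((cmod (exp (fst q)))\<^sup>2) * fst v"
    unfolding complex_norm_square by (simp only: mult_ac)
  have im: "Im (cnj (exp (fst q)) * (exp (fst q) * fst v)) = exp (2 * Re (fst q)) * Im (fst v)"
    unfolding eq Im_of_real_mult by (simp add: exp_double)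
  have "fst (log_chart q) = exp (fst q)"
    by (simp add: log_chart_def)
  then show ?thesis
    using contact[OF log_chart_in_cyl[OF q], of "(exp (fst q) * fst v, snd v)"]
    by (simp only: snd_Df[OF log_chart_in_cyl[OF q]] log_lift_def[symmetric] fst_conv snd_conv Im_log_lift_deriv[OF q] im mult.assoc)
qed

lemma phase_form_eqs:
  assumes q: "q \<in> strip"
  shows "phase_form q (1, 0) = 0"
    and "\<phi> (exp (2 * Re (fst q))) * phase_form q (\<i>, 0)
      = exp (2 * Re (fst q)) * (k + 2 * \<phi> (exp (2 * Re (fst q))) * phase_form q (0, 1))"
proof -
  have "\<phi> (exp (2 * Re (fst q))) > 0"
    using cmod_log_lift[OF q] log_lift_nonzero[OF q] by (metis zero_less_power2 norm_eq_zero)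
  \<comment> \<open>In the radial direction \<open>\<omega>\<close> and \<open>dt\<close> both
    vanish, which leaves only the term with \<open>phase_form\<close>, whose factor is
    positive.\<close>
  then show "phase_form q (1, 0) = 0"
    using contact_strip[OF q, of "(1, 0)"] by simp
  \<comment> \<open>With \<open>A\<close> and \<open>B\<close> the values of the form in the
    directions \<open>\<i>\<close> and \<open>t\<close>, the first gives
    \<open>\<phi> x * A = lam * x\<close> and the second \<open>k + 2 * \<phi> x * B = lam\<close>;
    substitution eliminates \<open>lam\<close>.\<close>
  show "\<phi> (exp (2 * Re (fst q))) * phase_form q (\<i>, 0)
      = exp (2 * Re (fst q)) * (k + 2 * \<phi> (exp (2 * Re (fst q))) * phase_form q (0, 1))"
    using contact_strip[OF q, of "(\<i>, 0)"] contact_strip[OF q, of "(0, 1)"] by simp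
qed

section \<open>Constancy of the phase form\<close>

lemma phase_form_expand:
  assumes q: "q \<in> strip"
  shows "phase_form q v = Im (fst v) * phase_form q (\<i>, 0) + snd v * phase_form q (0, 1)"
proof -
  have lin: "linear (phase_form q)"
    unfolding phase_form_def[abs_def]
    by (rule bounded_linear.linear, rule bounded_linear_compose[OF bounded_linear_Im],
        rule bounded_linear_compose[OF bounded_linear_mult_right], rule has_derivative_bounded_linear[OF has_derivative_phase[OF q]])
  have "v = Re (fst v) *\<^sub>R (1, 0) + Im (fst v) *\<^sub>R (\<i>, 0) + snd v *\<^sub>R (0, 1)"
    by (cases v) (simp add: complex_eq_iff)
  then have "phase_form q v = phase_form q (Re (fst v) *\<^sub>R (1, 0) + Im (fst v) *\<^sub>R (\<i>, 0) + snd v *\<^sub>R (0, 1))"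
    by simp
  also have "\<dots> = Re (fst v) * phase_form q (1, 0) + Im (fst v) * phase_form q (\<i>, 0) + snd v * phase_form q (0, 1)"
    using lin by (simp only: linear_add linear_scale real_scaleR_def)
  finally show ?thesis
    by (simp add: phase_form_eqs(1)[OF q])
qed

text \<open>The phase has zero derivative in the radial direction, and the radial shifts that stay
  in the strip form an interval.\<close>

lemma phase_translate:
  assumes q: "q \<in> strip" "q + (of_real s, 0) \<in> strip"
  shows "phase (q + (of_real s, 0)) = phase q"
proof -
  define S where "S = {u. Re (fst q) + u < ln b / 2}"
  have S: "S = {..<ln b / 2 - Re (fst q)}"
    by (auto simp: S_def)
  have "((\<lambda>u. phase (q + (of_real u, 0))) has_derivative (\<lambda>v. 0)) (at u within S)" if "u \<in> S" for u
  proof -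
    have u: "q + (of_real u, 0) \<in> strip"
      using that q(1) by (cases q) (auto simp: S_def strip_def)
    have "((\<lambda>u. q + (of_real u, 0)) has_derivative (\<lambda>v. (of_real v, 0))) (at u within S)"
      by (rule has_derivative_eq_rhs[OF has_derivative_add[OF has_derivative_const has_derivative_Pair[OF
                has_derivative_of_real[OF has_derivative_ident] has_derivative_const]]]) simp
    from has_derivative_compose[OF this has_derivative_phase[OF u]]
    have "((\<lambda>u. phase (q + (of_real u, 0))) has_derivative (\<lambda>v. phase_deriv (q + (of_real u, 0)) (of_real v, 0))) (at u within S)" .
    moreover have "phase_form (q + (of_real u, 0)) (of_real v, 0) = 0" for v
      using phase_form_expand[OF u, of "(of_real v, 0)"] by simp
    ultimately show ?thesis
      using phase_deriv_eq[OF u] by simp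
  qed
  moreover have "convex S" "s \<in> S" "0 \<in> S"
    unfolding S using q by (auto simp: strip_def)
  ultimately have "phase (q + (of_real s, 0)) = phase (q + (of_real 0, 0))"
    by (intro has_derivative_zero_unique[of S "\<lambda>u. phase (q + (of_real u, 0))" s 0])
  also have "q + (of_real 0, 0) = q"
    by (simp add: prod_eq_iff)
  finally show ?thesis .
qed

lemma phase_form_translate:
  assumes q: "q \<in> strip" "q + (of_real s, 0) \<in> strip"
  shows "phase_form (q + (of_real s, 0)) v = phase_form q v"
proof -
  have "((\<lambda>q::heis. q + (of_real s, 0)) has_derivative (\<lambda>v. v)) (at q)"
    by (rule has_derivative_eq_rhs[OF has_derivative_add[OF has_derivative_ident has_derivative_const]]) simp
  from has_derivative_compose[OF this has_derivative_phase[OF q(2)]]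
  have "((\<lambda>q. phase (q + (of_real s, 0))) has_derivative phase_deriv (q + (of_real s, 0))) (at q)" .
  moreover have "((\<lambda>q. phase (q + (of_real s, 0))) has_derivative phase_deriv q) (at q)"
  proof (rule has_derivative_transform_within_open[OF has_derivative_phase[OF q(1)]])
    show "open (strip \<inter> (\<lambda>q. q + (of_real s, 0)) -` strip)"
      by (intro open_Int open_strip open_vimage continuous_intros)
  qed (use q phase_translate in auto)
  ultimately have "phase_deriv (q + (of_real s, 0)) = phase_deriv q"
    by (rule has_derivative_unique)
  then show ?thesis
    by (simp add: phase_form_def phase_translate[OF q])
qed

text \<open>Radial shifts leave the coefficients unchanged but move
  \<open>exp (2 * Re (fst q))\<close> to any positive \<open>x\<close> below \<open>b\<close>; so
  the coefficients at one point satisfy the relation for all \<open>x\<close>.\<close>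

lemma phase_form_relation:
  assumes q: "q \<in> strip" and x: "0 < x" "x < b"
  shows "\<phi> x * phase_form q (\<i>, 0) = x * (k + 2 * \<phi> x * phase_form q (0, 1))"
proof -
  define s where "s = ln x / 2 - Re (fst q)"
  have s: "q + (of_real s, 0) \<in> strip"
    using q x b_pos by (auto simp: strip_def s_def)
  have "exp (2 * Re (fst (q + (of_real s, 0)))) = x"
    using x by (simp add: s_def)
  then show ?thesis
    using phase_form_eqs(2)[OF s] phase_form_translate[OF q s] by simp
qed

text \<open>Subtracting the relations at \<open>q\<close> and \<open>q'\<close> removes
  \<open>k\<close>, and cancelling \<open>\<phi> x\<close> leaves \<open>Q = 2 * x * P\<close> for
  every \<open>x\<close>. Two different values of \<open>x\<close> force both differences to
  vanish.\<close>

lemma phase_form_const: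
  assumes q: "q \<in> strip" "q' \<in> strip"
  shows "phase_form q (0, 1) = phase_form q' (0, 1)" and "phase_form q (\<i>, 0) = phase_form q' (\<i>, 0)"
proof -
  define P Q where "P = phase_form q (0, 1) - phase_form q' (0, 1)" and "Q = phase_form q (\<i>, 0) - phase_form q' (\<i>, 0)"
  have *: "Q = 2 * x * P" if "0 < x" "x < b" for x
  proof -
    have "\<phi> x * Q = \<phi> x * (2 * x * P)"
      using phase_form_relation[OF q(1) that] phase_form_relation[OF q(2) that] by (simp add: P_def Q_def algebra_simps)
    then show ?thesis
      using phi_pos[OF that] by simp
  qed
  have "2 * (b / 2) * P = 2 * (b / 4) * P"
    using *[of "b / 2"] *[of "b / 4"] b_pos by simp
  then have "P = 0" using b_pos by simp
  moreover from this have "Q = 0" using *[of "b / 2"] b_pos by simp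
  ultimately show "phase_form q (0, 1) = phase_form q' (0, 1)" "phase_form q (\<i>, 0) = phase_form q' (\<i>, 0)"
    by (simp_all add: P_def Q_def)
qed

text \<open>With constant coefficients \<open>d\<psi> = A d\<theta> + B dt\<close>. Dividing the
  phase by the corresponding exponential leaves a function \<open>G\<close> with zero derivative on
  a convex set, hence a constant of modulus 1.\<close>

lemma normal_form:
  obtains A B \<gamma> where
    "\<And>x. 0 < x \<Longrightarrow> x < b \<Longrightarrow> \<phi> x * (A - 2 * B * x) = k * x"
    "\<And>q. q \<in> strip \<Longrightarrow> log_lift q = of_real (sqrt (\<phi> (exp (2 * Re (fst q)))))
       * exp (\<i> * of_real (A * Im (fst q) + B * snd q + \<gamma>))"
proof -
  define q0 :: heis where "q0 = (of_real (ln b / 2 - 1), a / 2)"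
  have q0: "q0 \<in> strip"
    using a_pos by (simp add: q0_def strip_def)
  define A B where "A = phase_form q0 (\<i>, 0)" and "B = phase_form q0 (0, 1)"
  have AB: "phase_form q v = A * Im (fst v) + B * snd v" if "q \<in> strip" for q v
    using phase_form_expand[OF that, of v] unfolding phase_form_const[OF that q0] by (simp add: A_def B_def mult.commute)
  have "\<phi> x * (A - 2 * B * x) = k * x" if "0 < x" "x < b" for x
    using phase_form_relation[OF q0 that] by (simp add: A_def B_def algebra_simps)
  moreover
  define G where "G q = phase q * exp (- \<i> * of_real (A * Im (fst q) + B * snd q))" for q
  have "(G has_derivative (\<lambda>v. 0)) (at q within strip)" if q: "q \<in> strip" for q
  proof -
    have "((\<lambda>q::heis. - \<i> * of_real (A * Im (fst q) + B * snd q)) has_derivative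
        (\<lambda>v. - \<i> * of_real (A * Im (fst v) + B * snd v))) (at q)"
      by (intro has_derivative_mult_right has_derivative_of_real has_derivative_add has_derivative_Im
          has_derivative_fst has_derivative_snd has_derivative_ident)
    from has_derivative_mult[OF has_derivative_phase[OF q] has_derivative_compose[OF this DERIV_exp[unfolded has_field_derivative_def]]]
    have "(G has_derivative (\<lambda>v. 0)) (at q)"
      unfolding G_def[abs_def]
      by (rule has_derivative_eq_rhs) (auto simp: fun_eq_iff phase_deriv_eq[OF q] AB[OF q] algebra_simps)
    then show ?thesis
      by (rule has_derivative_at_withinI)
  qed
  then obtain c where c: "\<And>q. q \<in> strip \<Longrightarrow> G q = c"
    using has_derivative_zero_constant[OF convex_strip] by blast
  have "cmod c = 1"
    using c[OF q0] cmod_phase[OF q0] by (auto simp: G_def norm_mult)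
  then obtain \<gamma> where \<gamma>: "c = exp (\<i> * of_real \<gamma>)"
    using complex_norm_eq_1_exp by metis
  have "log_lift q = of_real (sqrt (\<phi> (exp (2 * Re (fst q))))) * exp (\<i> * of_real (A * Im (fst q) + B * snd q + \<gamma>))"
    if q: "q \<in> strip" for q
  proof -
    define \<theta> where "\<theta> = A * Im (fst q) + B * snd q"
    have "phase q = G q * exp (\<i> * of_real \<theta>)"
      by (simp add: G_def \<theta>_def flip: exp_add)
    also have "\<dots> = exp (\<i> * of_real (\<theta> + \<gamma>))"
      unfolding c[OF q] \<gamma> by (simp add: algebra_simps flip: exp_add)
    finally have "phase q = exp (\<i> * of_real (\<theta> + \<gamma>))" .
    moreover have "cmod (log_lift q) = sqrt (\<phi> (exp (2 * Re (fst q))))"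
      by (simp flip: cmod_log_lift[OF q])
    ultimately show ?thesis
      using log_lift_eq[OF q] by (simp add: \<theta>_def)
  qed
  ultimately show ?thesis
    using that by blast
qed

end

section \<open>Admissible profiles\<close>

lemma admissible_derivative:
  assumes "admissible a b a' b' \<phi>"
  obtains \<phi>' where "\<And>x. x \<in> {0..b} \<Longrightarrow> (\<phi> has_real_derivative \<phi>' x) (at x within {0..b})"
    and "\<And>x. x \<in> {0..b} \<Longrightarrow> \<phi>' x \<ge> a' / a"
proof -
  have "\<forall>x\<in>{0..b}. \<exists>D. (\<phi> has_real_derivative D) (at x within {0..b}) \<and> D \<ge> a' / a"
    using assms by (simp add: admissible_def)
  from bchoice[OF this] show ?thesis
    using that by blast
qed

lemma admissible_continuous_on:
  assumes "admissible a b a' b' \<phi>"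
  shows "continuous_on {0..b} \<phi>"
  by (rule admissible_derivative[OF assms]) (rule DERIV_continuous_on)

text \<open>By the mean value theorem; the lower bound on the slope enters the uniqueness proof in
  this integrated form.\<close>

lemma admissible_ge:
  assumes "admissible a b a' b' \<phi>" "x \<in> {0..b}"
  shows "a' / a * x \<le> \<phi> x"
proof (cases "x = 0")
  case True
  then show ?thesis using assms by (simp add: admissible_def)
next
  case False
  obtain \<phi>' where \<phi>': "\<And>x. x \<in> {0..b} \<Longrightarrow> (\<phi> has_real_derivative \<phi>' x) (at x within {0..b})"
    "\<And>x. x \<in> {0..b} \<Longrightarrow> \<phi>' x \<ge> a' / a"
    using admissible_derivative[OF assms(1)] by metis
  have "continuous_on {0..x} \<phi>"
    by (rule continuous_on_subset[OF admissible_continuous_on[OF assms(1)]]) (use assms(2) in auto)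
  moreover have "(\<phi> has_derivative (*) (\<phi>' y)) (at y)" if "0 < y" "y < x" for y
    using \<phi>'(1)[of y] at_within_Icc_at[of 0 y b] that assms(2) by (auto simp: has_field_derivative_def)
  ultimately obtain \<xi> where \<xi>: "\<xi> \<in> {0<..<x}" "\<phi> x - \<phi> 0 = \<phi>' \<xi> * (x - 0)"
    using mvt[of 0 x \<phi> "\<lambda>y. (*) (\<phi>' y)"] False assms(2) by auto
  have "a' / a * x \<le> \<phi>' \<xi> * x"
    using \<phi>'(2)[of \<xi>] \<xi>(1) assms(2) by (intro mult_right_mono) auto
  then show ?thesis
    using \<xi>(2) assms(1) by (simp add: admissible_def)
qed

text \<open>The coefficient \<open>n - 2 * B * x\<close> equals \<open>k * x / \<phi> x\<close> and
  so lies between 0 and 1; letting \<open>x\<close> tend to 0 leaves \<open>n = 0\<close> or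
  \<open>n = 1\<close>. For \<open>n = 0\<close> the equation reads
  \<open>- 2 * B * \<phi> x = k\<close>, which contradicts \<open>\<phi> x\<close> tending to
  0.\<close>

lemma profile_coefficient_eq_one:
  fixes \<phi> :: "real \<Rightarrow> real"
  assumes "b > 0" "k > 0" "continuous_on {0..b} \<phi>" "\<phi> 0 = 0"
    and ge: "\<And>x. x \<in> {0..b} \<Longrightarrow> k * x \<le> \<phi> x"
    and eq: "\<And>x. 0 < x \<Longrightarrow> x < b \<Longrightarrow> \<phi> x * (real_of_int n - 2 * B * x) = k * x"
  shows "n = 1"
proof -
  have ev: "\<forall>\<^sub>F x in at_right 0. 0 < x \<and> x < b"
    using eventually_at_right_real[OF assms(1)] by simp
  have lim: "((\<lambda>x. real_of_int n - 2 * B * x) \<longlongrightarrow> real_of_int n - 2 * B * 0) (at_right 0)"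
    by (intro tendsto_intros)
  have bounds: "0 \<le> real_of_int n - 2 * B * x \<and> real_of_int n - 2 * B * x \<le> 1" if "0 < x" "x < b" for x
  proof -
    have p: "\<phi> x \<ge> k * x" "k * x > 0"
      using ge[of x] that assms by auto
    then have "0 \<le> real_of_int n - 2 * B * x"
      using eq[OF that] by (smt (verit) zero_less_mult_iff)
    moreover have "real_of_int n - 2 * B * x \<le> 1"
    proof (rule ccontr)
      assume "\<not> ?thesis"
      then have "\<phi> x * 1 < \<phi> x * (real_of_int n - 2 * B * x)"
        using p by (intro mult_strict_left_mono) auto
      then show False using eq[OF that] p by simp
    qed
    ultimately show ?thesis by simp
  qed
  have "\<forall>\<^sub>F x in at_right 0. real_of_int n - 2 * B * x \<le> 1"
    using ev by (rule eventually_mono) (use bounds in blast)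
  from tendsto_upperbound[OF lim this] have "real_of_int n \<le> 1"
    by simp
  moreover have "\<forall>\<^sub>F x in at_right 0. 0 \<le> real_of_int n - 2 * B * x"
    using ev by (rule eventually_mono) (use bounds in blast)
  from tendsto_lowerbound[OF lim this] have "0 \<le> real_of_int n"
    by simp
  moreover have "n \<noteq> 0"
  proof
    assume n: "n = 0"
    have "(\<phi> \<longlongrightarrow> 0) (at_right 0)"
      using assms(1,3,4) by (metis atLeastAtMost_iff at_within_Icc_at_right continuous_on less_imp_le order_refl)
    then have "((\<lambda>x. \<phi> x * (- 2 * B)) \<longlongrightarrow> 0 * (- 2 * B)) (at_right 0)"
      by (intro tendsto_intros)
    moreover have "\<forall>\<^sub>F x in at_right 0. \<phi> x * (- 2 * B) = k"
      using ev
    proof eventually_elim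
      case (elim x)
      then have "x * (\<phi> x * (- 2 * B)) = x * k"
        using eq[of x] n by (simp add: mult_ac)
      then show ?case
        using elim by (metis less_irrefl mult_left_cancel)
    qed
    ultimately have "((\<lambda>x::real. k) \<longlongrightarrow> 0) (at_right 0)"
      by (simp add: tendsto_cong)
    then show False
      using assms(2) by (simp add: tendsto_const_iff)
  qed
  ultimately show ?thesis by linarith
qed

text \<open>The normal form lives on the logarithmic strip. Descending to the cylinder makes
  \<open>A\<close> an integer, the profile makes it 1, \<open>\<phi> b = b'\<close> fixes
  \<open>B = \<beta>\<close>, and continuity reaches the axis.\<close>

lemma is_lift_heis_twist:
  assumes pos: "a > 0" "b > 0" "a' > 0" "b' > 0"
    and adm: "admissible a b a' b' \<phi>" and lift: "is_lift a b a' b' \<phi> f"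
  defines "\<beta> \<equiv> (1 - a' * b / (a * b')) / (2 * b)"
  shows "\<forall>x\<in>{0..b}. \<phi> x * (1 - 2 * \<beta> * x) = a' / a * x"
    and "\<exists>\<gamma>. \<forall>p\<in>cyl a b. f p = heis_twist (a' / a) \<beta> \<gamma> p"
proof -
  define k where "k = a' / a"
  have k: "k > 0" using pos by (simp add: k_def)
  have cont: "continuous_on {0..b} \<phi>"
    using admissible_continuous_on[OF adm] .
  have \<phi>0: "\<phi> 0 = 0" and \<phi>b: "\<phi> b = b'"
    using adm by (auto simp: admissible_def)
  have ge: "k * x \<le> \<phi> x" if "x \<in> {0..b}" for x
    using admissible_ge[OF adm that] by (simp add: k_def)
  have qc: "C2_on (cyl a b) f" "contact_on (cyl a b) f"
    using lift by (auto simp: is_lift_def heis_quasiconformal_def)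
  obtain f' where f': "\<forall>p\<in>cyl a b. (f has_derivative blinfun_apply (f' p)) (at p)"
    using qc(1) unfolding C2_on_def by blast
  obtain lam :: "heis \<Rightarrow> real" where lam: "\<And>p v. p \<in> cyl a b \<Longrightarrow>
      heis_form (f p) (frechet_derivative f (at p) v) = of_real (lam p) * heis_form p v"
    using qc(2) unfolding contact_on_def by metis
  have off: "snd (f p) = k * snd p" "(cmod (fst (f p)))\<^sup>2 = \<phi> ((cmod (fst p))\<^sup>2)"
    if p: "p \<in> cyl a b" "fst p \<noteq> 0" for p
  proof -
    have "heis_proj p \<in> rect a b"
      using p cyl_iff[OF pos(2)] by (auto simp: heis_proj_def rect_def simp flip: of_real_power)
    then have "heis_proj (f p) = f_phi a a' \<phi> (heis_proj p)"
      using lift p by (simp add: is_lift_def)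
    then show "snd (f p) = k * snd p" "(cmod (fst (f p)))\<^sup>2 = \<phi> ((cmod (fst p))\<^sup>2)"
      by (simp_all add: heis_proj_def f_phi_def k_def complex_eq_iff flip: of_real_power)
  qed
  interpret contact_lift f "\<lambda>p. blinfun_apply (f' p)" lam \<phi> a b k
  proof
    show "\<phi> x > 0" if "0 < x" "x < b" for x
      using less_le_trans[OF mult_pos_pos[OF k that(1)] ge[of x]] that by simp
    show "snd (blinfun_apply (f' p) v) + 2 * Im (cnj (fst (f p)) * fst (blinfun_apply (f' p) v))
        = lam p * (snd v + 2 * Im (cnj (fst p) * fst v))" if "p \<in> cyl a b" for p v
    proof -
      have "frechet_derivative f (at p) = blinfun_apply (f' p)"
        using frechet_derivative_at[OF bspec[OF f' that]] by simp
      then have "complex_of_real (snd (blinfun_apply (f' p) v) + 2 * Im (cnj (fst (f p)) * fst (blinfun_apply (f' p) v)))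
        = of_real (lam p * (snd v + 2 * Im (cnj (fst p) * fst v)))"
        using lam[OF that, of v] unfolding heis_form_eq of_real_mult by simp
      then show ?thesis
        by (simp only: of_real_eq_iff)
    qed
  qed (use pos k f' off in auto)
  obtain A B \<gamma> where eqA: "\<And>x. 0 < x \<Longrightarrow> x < b \<Longrightarrow> \<phi> x * (A - 2 * B * x) = k * x"
    and normal: "\<And>q. q \<in> strip \<Longrightarrow> log_lift q = of_real (sqrt (\<phi> (exp (2 * Re (fst q)))))
       * exp (\<i> * of_real (A * Im (fst q) + B * snd q + \<gamma>))"
    using normal_form by blast
  obtain n :: int where n: "A = of_int n"
  proof -
    \<comment> \<open>\<open>q\<close> and \<open>q'\<close> differ by a full turn and represent the
      same point of the cylinder, so the lift has the same value at both, which forces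
      \<open>exp (\<i> * (A * (2 * pi))) = 1\<close>.\<close>
    define q :: heis where "q = (of_real (ln b / 2 - 1), a / 2)"
    define q' where "q' = q + (of_real (2 * pi) * \<i>, 0)"
    have q: "q \<in> strip" "q' \<in> strip"
      using pos by (auto simp: q_def q'_def strip_def)
    have "log_chart q' = log_chart q"
      by (simp add: log_chart_def q'_def q_def exp_add mult.commute)
    then have "log_lift q' = log_lift q"
      by (simp add: log_lift_def)
    have "exp (\<i> * of_real (A * Im (fst q') + B * snd q' + \<gamma>))
        = exp (\<i> * of_real (A * (2 * pi))) * exp (\<i> * of_real (A * Im (fst q) + B * snd q + \<gamma>))"
      by (simp add: q'_def algebra_simps flip: exp_add)
    then have "log_lift q' = exp (\<i> * of_real (A * (2 * pi))) * log_lift q"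
      unfolding normal[OF q(1)] normal[OF q(2)] by (simp add: q'_def mult_ac)
    then have "exp (\<i> * of_real (A * (2 * pi))) = 1"
      using \<open>log_lift q' = log_lift q\<close> log_lift_nonzero[OF q(1)] by simp
    then obtain n :: int where "A * (2 * pi) = of_int (2 * n) * pi"
      by (auto simp: exp_eq_1)
    then have "A = of_int n" by simp
    then show ?thesis using that by blast
  qed
  have "n = 1"
    by (rule profile_coefficient_eq_one[OF pos(2) k cont \<phi>0 ge eqA[unfolded n]])
  then have A: "A = 1" by (simp add: n)
  have eqB: "\<phi> x * (1 - 2 * B * x) = k * x" if "x \<in> {0..b}" for x
  proof -
    \<comment> \<open>The relation is known on the open interval; continuity carries it to the end
      point \<open>b\<close>, where \<open>\<phi> b = b'\<close> determines
      \<open>B\<close>.\<close>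
    have "\<phi> x * (1 - 2 * B * x) - k * x = 0" if "x \<in> closure {0<..<b}" for x
    proof (rule continuous_constant_on_closure[OF _ _ that])
      show "continuous_on (closure {0<..<b}) (\<lambda>x. \<phi> x * (1 - 2 * B * x) - k * x)"
        using pos by (auto intro!: continuous_intros cont)
    qed (use eqA A in auto)
    then show ?thesis
      using that pos by simp
  qed
  have "b' * (1 - 2 * B * b) = k * b"
    using eqB[of b] \<phi>b pos by simp
  then have "1 - 2 * B * b = k * b / b'"
    using pos by (intro eq_divide_imp) (auto simp: mult.commute)
  then have "1 - 2 * B * b = a' * b / (a * b')"
    by (simp add: k_def)
  then have "B * (2 * b) = 1 - a' * b / (a * b')"
    by linarith
  then have B: "B = \<beta>"
    unfolding \<beta>_def using pos by (intro eq_divide_imp) auto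
  show "\<forall>x\<in>{0..b}. \<phi> x * (1 - 2 * \<beta> * x) = a' / a * x"
    using eqB B k_def by simp
  have "f p = heis_twist k \<beta> \<gamma> p" if p: "p \<in> cyl a b" for p
  proof (cases "fst p = 0")
    case False
    define w where "w = Ln (fst p)"
    define q where "q = (w, snd p)"
    have w: "exp w = fst p" using False by (simp add: w_def)
    have x: "exp (2 * Re w) = (cmod (fst p))\<^sup>2"
      by (simp add: exp_double flip: w)
    have xb: "exp (2 * Re w) < b"
      using p cyl_iff[OF pos(2)] unfolding x by blast
    then have "2 * Re w < ln b"
      using pos(2) by (metis exp_less_cancel_iff exp_ln)
    then have q: "q \<in> strip"
      using p cyl_iff[OF pos(2)] by (simp add: q_def strip_def)
    have "log_chart q = p" by (simp add: log_chart_def q_def w)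
    then have Fq: "fst (f p) = log_lift q" by (simp add: log_lift_def)
    define X where "X = exp (2 * Re w)"
    have "\<phi> X * (1 - 2 * \<beta> * X) = k * X" "\<phi> X > 0" "k * X > 0"
      using eqB[of X] B xb phi_pos[of X] k by (auto simp: X_def)
    then have "1 - 2 * \<beta> * X > 0" by (metis zero_less_mult_pos)
    with \<open>\<phi> X * (1 - 2 * \<beta> * X) = k * X\<close> have "\<phi> X = X * (k / (1 - 2 * \<beta> * X))"
      by (simp add: field_simps)
    \<comment> \<open>The modulus \<open>sqrt (\<phi> X)\<close> splits into
      \<open>cmod (fst p)\<close> and the radial factor; with the polar form of \<open>exp w\<close>
      the normal form becomes a twist.\<close>
    then have "sqrt (\<phi> X) = sqrt X * twist_scale k \<beta> X"
      by (simp only: twist_scale_def real_sqrt_mult)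
    also have "sqrt X = exp (Re w)"
      by (simp add: X_def exp_double)
    finally have "fst (f p) = (of_real (exp (Re w)) * exp (\<i> * of_real (Im w))) * of_real (twist_scale k \<beta> X) *
        exp (\<i> * of_real (\<gamma> + \<beta> * snd p))"
      unfolding Fq normal[OF q] A B by (simp add: q_def X_def algebra_simps exp_add)
    also have "of_real (exp (Re w)) * exp (\<i> * of_real (Im w)) = fst p"
      unfolding w[symmetric] exp_eq_polar[of w] cis_conv_exp ..
    finally show ?thesis
      using off(1)[OF p False] x by (simp add: heis_twist_def prod_eq_iff X_def)
  next
    case True
    \<comment> \<open>On the axis there is no logarithm; the value is the limit along the points
      \<open>(s, t)\<close> with real \<open>s\<close> tending to 0 from above.\<close>
    define t where "t = snd p"
    have p0: "p = (0, t)" using True by (simp add: t_def prod_eq_iff)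
    have ev: "\<forall>\<^sub>F s in at_right 0. 0 < s \<and> s < sqrt b"
      using eventually_at_right_real[of 0 "sqrt b"] pos by simp
    have "isCont f p"
      using f' p has_derivative_continuous by blast
    moreover have lim0: "((\<lambda>s. (complex_of_real s, t)) \<longlongrightarrow> p) (at_right 0)"
      unfolding p0 by (auto intro!: tendsto_eq_intros)
    ultimately have lim: "((\<lambda>s. f (complex_of_real s, t)) \<longlongrightarrow> f p) (at_right 0)"
      using isCont_tendsto_compose by blast
    have in': "(complex_of_real s, t) \<in> cyl a b" "fst (complex_of_real s, t) \<noteq> 0" if "0 < s" "s < sqrt b" for s
      using p that by (auto simp: cyl_def p0)
    have "\<forall>\<^sub>F s in at_right 0. snd (f (complex_of_real s, t)) = k * t"
      using ev by eventually_elim (use off(1)[OF in'] in auto)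
    then have "snd (f p) = k * t"
      using tendsto_unique[OF trivial_limit_at_right_real tendsto_snd[OF lim] tendsto_eventually] by blast
    moreover have "cmod (fst (f p)) = 0"
    proof -
      have "(\<phi> \<longlongrightarrow> \<phi> 0) (at 0 within {0..b})"
        using cont pos by (simp add: continuous_on)
      \<comment> \<open>\<open>\<phi>\<close> is continuous within \<open>{0..b}\<close>, so
        \<open>s\<^sup>2\<close> has to approach 0 inside this interval.\<close>
      moreover have "filterlim (\<lambda>s::real. s\<^sup>2) (at 0 within {0..b}) (at_right 0)"
        unfolding filterlim_at
      proof
        show "\<forall>\<^sub>F s in at_right 0. s\<^sup>2 \<in> {0..b} \<and> s\<^sup>2 \<noteq> (0::real)"
          using ev
        proof eventually_elim
          case (elim s)
          then have "s\<^sup>2 < (sqrt b)\<^sup>2" by (intro power_strict_mono) auto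
          then show ?case using elim pos by auto
        qed
      qed (auto intro!: tendsto_eq_intros)
      ultimately have "((\<lambda>s. \<phi> (s\<^sup>2)) \<longlongrightarrow> 0) (at_right 0)"
        using \<phi>0 filterlim_compose[of \<phi> "nhds 0" "at 0 within {0..b}" "\<lambda>s. s\<^sup>2" "at_right 0"] by simp
      moreover have "\<forall>\<^sub>F s in at_right 0. (cmod (fst (f (complex_of_real s, t))))\<^sup>2 = \<phi> (s\<^sup>2)"
        using ev by eventually_elim (use off(2)[OF in'] in auto)
      ultimately have "((\<lambda>s. (cmod (fst (f (complex_of_real s, t))))\<^sup>2) \<longlongrightarrow> 0) (at_right 0)"
        by (simp add: tendsto_cong)
      moreover have "((\<lambda>s. (cmod (fst (f (complex_of_real s, t))))\<^sup>2) \<longlongrightarrow> (cmod (fst (f p)))\<^sup>2) (at_right 0)"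
        by (intro tendsto_intros lim)
      ultimately have "(cmod (fst (f p)))\<^sup>2 = 0"
        by (rule tendsto_unique[OF trivial_limit_at_right_real, rotated])
      then show ?thesis by simp
    qed
    ultimately show ?thesis
      by (simp add: heis_twist_def True prod_eq_iff t_def)
  qed
  then show "\<exists>\<gamma>. \<forall>p\<in>cyl a b. f p = heis_twist (a' / a) \<beta> \<gamma> p"
    by (auto simp: k_def)
qed

section \<open>The extremal stretch\<close>

context
  fixes a b a' b' :: real
  assumes pos: "a > 0" "b > 0" "a' > 0" "b' > 0" and gt: "a * b' / (a' * b) > 1"
begin

text \<open>This is the \<open>\<beta>\<close> for which the profile sends \<open>b\<close> to
  \<open>b'\<close>; it is also the rate at which \<open>lift0\<close> rotates with
  \<open>t\<close>.\<close>

definition twist_rate :: real where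
  "twist_rate = (1 - a' * b / (a * b')) / (2 * b)"

lemma one_minus_twist_rate: "1 - 2 * twist_rate * b = a' * b / (a * b')"
proof -
  have "y / (2 * b) * (2 * b) = y" for y
    using pos by simp
  from this[of "1 - a' * b / (a * b')"] show ?thesis
    unfolding twist_rate_def[symmetric] by linarith
qed

lemma twist_rate_bounds: "0 \<le> twist_rate" "2 * twist_rate * b < 1"
proof -
  have "a' * b / (a * b') > 0"
    using pos by simp
  then show "2 * twist_rate * b < 1"
    using one_minus_twist_rate by linarith
  \<comment> \<open>The hypothesis on the ratio enters here: it makes the rate nonnegative, on which
    the dilatation estimate and the slope condition for \<open>phi0\<close> rely.\<close>
  have "a' * b / (a * b') < 1"
    using gt pos by (simp add: field_simps)
  then show "0 \<le> twist_rate"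
    using pos by (simp add: twist_rate_def)
qed

lemma twist_rate_le: "x \<in> {0..b} \<Longrightarrow> 0 < 1 - 2 * twist_rate * x \<and> 1 - 2 * twist_rate * x \<le> 1"
  using twist_mult_less_one[OF twist_rate_bounds(2), of x] twist_rate_bounds(1) by auto

text \<open>Factoring out \<open>a * b' / a'\<close> exhibits the \<open>1 - 2 * \<beta> * x\<close>
  of the twists and so identifies \<open>phi0\<close> and \<open>lift0\<close> as a profile and a
  map of that family.\<close>

lemma denominator_eq:
  "(1 - a * b' / (a' * b)) * x + a * b' / a' = (a * b' / a') * (1 - 2 * twist_rate * x)"
  using pos by (simp add: twist_rate_def field_simps)

lemma phi0_eq: "phi0 a b a' b' x = a' / a * x / (1 - 2 * twist_rate * x)"
proof -
  have "phi0 a b a' b' x = b' / (a * b' / a') * x / (1 - 2 * twist_rate * x)"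
    unfolding phi0_def denominator_eq by (simp only: times_divide_eq_left divide_divide_eq_left)
  also have "b' / (a * b' / a') = a' / a"
    using pos by simp
  finally show ?thesis .
qed

text \<open>The map \<open>lift0\<close> is the twist with phase constant 0, and rotating about the
  axis adds \<open>\<alpha>\<close> to that constant.\<close>

lemma heis_rot_lift0_eq:
  "heis_rot \<alpha> (lift0 a b a' b' p) = heis_twist (a' / a) twist_rate \<alpha> p"
proof -
  define y where "y = 1 - 2 * twist_rate * (cmod (fst p))\<^sup>2"
  have "sqrt b' / sqrt ((1 - a * b' / (a' * b)) * (cmod (fst p))\<^sup>2 + a * b' / a')
      = sqrt (b' / ((a * b' / a') * y))"
    unfolding denominator_eq y_def by (simp only: real_sqrt_divide)
  also have "b' / ((a * b' / a') * y) = b' / (a * b' / a') / y"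
    by (simp only: divide_divide_eq_left)
  also have "b' / (a * b' / a') = a' / a"
    using pos by simp
  finally have s: "complex_of_real (sqrt b') / of_real (sqrt ((1 - a * b' / (a' * b)) * (cmod (fst p))\<^sup>2 + a * b' / a'))
      = of_real (twist_scale (a' / a) twist_rate ((cmod (fst p))\<^sup>2))"
    unfolding twist_scale_def y_def by (metis of_real_divide)
  have "\<i> / of_real (2 * b) * of_real (1 - a' * b / (a * b')) * of_real (snd p)
      = \<i> * complex_of_real (twist_rate * snd p)"
    by (simp add: twist_rate_def)
  then have e: "exp (\<i> * of_real \<alpha>) * exp (\<i> / of_real (2 * b) * of_real (1 - a' * b / (a * b')) * of_real (snd p))
      = exp (\<i> * of_real (\<alpha> + twist_rate * snd p))"
    by (simp add: distrib_left exp_add)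
  have "fst (heis_rot \<alpha> (lift0 a b a' b' p)) = fst p *
      (complex_of_real (sqrt b') / of_real (sqrt ((1 - a * b' / (a' * b)) * (cmod (fst p))\<^sup>2 + a * b' / a'))) *
      (exp (\<i> * of_real \<alpha>) * exp (\<i> / of_real (2 * b) * of_real (1 - a' * b / (a * b')) * of_real (snd p)))"
    by (simp add: heis_rot_def lift0_def case_prod_beta)
  then show ?thesis
    unfolding s e by (simp add: prod_eq_iff heis_twist_def heis_rot_def lift0_def case_prod_beta)
qed

lemma admissible_phi0: "admissible a b a' b' (phi0 a b a' b')"
  unfolding admissible_def
proof (intro conjI ballI)
  show "phi0 a b a' b' 0 = 0" by (simp add: phi0_eq)
  show \<phi>b: "phi0 a b a' b' b = b'"
    unfolding phi0_eq one_minus_twist_rate using pos by simp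
  show "phi0 a b a' b' \<in> {0..b} \<rightarrow> {0..b'}"
  proof
    fix x assume x: "x \<in> {0..b}"
    have "a' / a * x / (1 - 2 * twist_rate * x) \<le> a' / a * b / (1 - 2 * twist_rate * b)"
      using x pos twist_rate_le[of b] twist_rate_bounds(1)
      by (intro frac_le mult_left_mono) (auto intro!: mult_left_mono)
    then show "phi0 a b a' b' x \<in> {0..b'}"
      using \<phi>b x pos twist_rate_le[OF x] by (simp add: phi0_eq)
  qed
  fix x assume x: "x \<in> {0..b}"
  define y where "y = 1 - 2 * twist_rate * x"
  have y: "0 < y" "y \<le> 1" using twist_rate_le[OF x] by (auto simp: y_def)
  \<comment> \<open>The slope comes out as \<open>a' / a\<close> divided by the square of
    \<open>y\<close>, where \<open>0 < y \<le> 1\<close>, hence it is at least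
    \<open>a' / a\<close>.\<close>
  have "((\<lambda>x. c * x / (1 - 2 * twist_rate * x)) has_real_derivative c / y\<^sup>2) (at x within {0..b})" for c
    using y unfolding y_def by (auto intro!: derivative_eq_intros simp: power2_eq_square algebra_simps)
  from this[of "a' / a"] have "(phi0 a b a' b' has_real_derivative a' / a / y\<^sup>2) (at x within {0..b})"
    unfolding phi0_eq[abs_def] .
  moreover have "a' / a / y\<^sup>2 \<ge> a' / a"
    using y pos by (simp add: pos_le_divide_eq power_le_one)
  ultimately show "\<exists>D. (phi0 a b a' b' has_real_derivative D) (at x within {0..b}) \<and> D \<ge> a' / a"
    by blast
qed

lemma admissible_cong:
  assumes "admissible a b a' b' \<psi>" "\<And>x. x \<in> {0..b} \<Longrightarrow> \<phi> x = \<psi> x"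
  shows "admissible a b a' b' \<phi>"
proof -
  have "(\<phi> has_real_derivative D) (at x within {0..b})"
    if "(\<psi> has_real_derivative D) (at x within {0..b})" "x \<in> {0..b}" for D x
    using has_field_derivative_transform_within[OF that(1) zero_less_one that(2)] assms(2) by auto
  moreover have "0 \<in> {0..b}" "b \<in> {0..b}"
    using pos by auto
  moreover have "\<phi> \<in> {0..b} \<rightarrow> {0..b'} \<longleftrightarrow> \<psi> \<in> {0..b} \<rightarrow> {0..b'}"
    using assms(2) by (intro Pi_cong) auto
  ultimately show ?thesis
    using assms unfolding admissible_def by metis
qed

lemma is_lift_if_twist:
  assumes \<phi>: "\<And>x. x \<in> {0..b} \<Longrightarrow> \<phi> x = phi0 a b a' b' x"
    and f: "\<forall>p\<in>cyl a b. f p = heis_twist (a' / a) twist_rate \<alpha> p"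
  shows "is_lift a b a' b' \<phi> f"
  unfolding is_lift_def
proof (intro conjI ballI impI)
  have "a' / a * b / (1 - 2 * twist_rate * b) = b'"
    unfolding one_minus_twist_rate using pos by simp
  then show "heis_quasiconformal (cyl a b) (cyl a' b') f"
    using heis_quasiconformal_heis_twist[OF _ pos(1,2) twist_rate_bounds f] pos by simp
  fix p assume p: "p \<in> cyl a b"
  define x where "x = (cmod (fst p))\<^sup>2"
  have x: "x \<in> {0..b}" "2 * twist_rate * x < 1"
    using p cyl_iff[OF pos(2)] twist_rate_le[of x] by (auto simp: x_def)
  have "(cmod (fst (f p)))\<^sup>2 = phi0 a b a' b' x"
    using cmod_heis_twist_fst_sq[of "a' / a" twist_rate p \<alpha>] x(2) f p pos by (simp add: phi0_eq x_def)
  moreover have "snd (f p) = a' / a * snd p"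
    using f p by (simp add: heis_twist_def)
  ultimately show "heis_proj (f p) = f_phi a a' \<phi> (heis_proj p)"
    using \<phi>[OF x(1)] by (simp add: heis_proj_def f_phi_def complex_eq_iff x_def flip: of_real_power)
qed

lemma phi0_unique:
  assumes "admissible a b a' b' \<phi>" "is_lift a b a' b' \<phi> f" "x \<in> {0..b}"
  shows "\<phi> x = phi0 a b a' b' x"
  using is_lift_heis_twist(1)[OF pos assms(1,2)] assms(3) twist_rate_le[OF assms(3)]
  unfolding phi0_eq twist_rate_def[symmetric] by (intro eq_divide_imp) auto

lemma is_lift_phi0_iff:
  "is_lift a b a' b' (phi0 a b a' b') f \<longleftrightarrow>
    (\<exists>\<alpha>. \<forall>p\<in>cyl a b. f p = heis_rot \<alpha> (lift0 a b a' b' p))"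
  unfolding heis_rot_lift0_eq
proof
  show "\<exists>\<alpha>. \<forall>p\<in>cyl a b. f p = heis_twist (a' / a) twist_rate \<alpha> p"
    if "is_lift a b a' b' (phi0 a b a' b') f"
    using is_lift_heis_twist(2)[OF pos admissible_phi0 that] unfolding twist_rate_def .
qed (auto intro: is_lift_if_twist)

end

theorem proposition2p1p3:
  fixes a b a' b' :: real
  assumes "a > 0" and "b > 0" and "a' > 0" and "b' > 0"
    and "a * b' / (a' * b) > 1"
  shows "(\<forall>\<phi> :: real \<Rightarrow> real.
            (admissible a b a' b' \<phi> \<and> (\<exists>f. is_lift a b a' b' \<phi> f)) \<longleftrightarrow>
            (\<forall>x\<in>{0..b}. \<phi> x = phi0 a b a' b' x))
       \<and> (\<forall>f :: heis \<Rightarrow> heis.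
            is_lift a b a' b' (phi0 a b a' b') f \<longleftrightarrow>
            (\<exists>\<alpha> :: real. \<forall>p\<in>cyl a b. f p = heis_rot \<alpha> (lift0 a b a' b' p)))"
proof (intro conjI allI iffI ballI)
  fix \<phi> :: "real \<Rightarrow> real"
  assume \<phi>: "\<forall>x\<in>{0..b}. \<phi> x = phi0 a b a' b' x"
  show "admissible a b a' b' \<phi>"
    by (rule admissible_cong[OF assms admissible_phi0[OF assms]]) (use \<phi> in simp)
  show "\<exists>f. is_lift a b a' b' \<phi> f"
    using is_lift_if_twist[OF assms bspec[OF \<phi>], of "heis_twist (a' / a) (twist_rate a b a' b') 0" 0] by blast
next
  show "\<phi> x = phi0 a b a' b' x"
    if "admissible a b a' b' \<phi> \<and> (\<exists>f. is_lift a b a' b' \<phi> f)" "x \<in> {0..b}" for \<phi> x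
    using that phi0_unique[OF assms] by blast
qed (use is_lift_phi0_iff[OF assms] in simp_all)

end
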